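(* Let $G$ be a trapezoid graph and $U=\{u_1,\ldots,u_k\}$ a set of vertices of $G$ such that $\delta^*_{u_i}\neq\emptyset$ for every $i=1,\ldots,k$. Let $H_0=G$, let $H_i=H_{i-1}^{\#}(u_i)$ be obtained from $H_{i-1}$ by the vertex splitting of $u_i$ (for $i=1,\ldots,k$), and let $G^{\#}(U)$ be the subgraph of $H_k$ induced by all vertices except those of $V(G)\setminus U$ (i.e., only the derivatives remain). Then $G^{\#}(U)$ is a permutation graph with $2k$ vertices. Furthermore, if $G$ is an acyclic trapezoid graph, then $G^{\#}(U)$ is an acyclic permutation graph with respect to $\{u_i^1,u_i^2\}_{i=1}^k$, where $u_i^1,u_i^2$ are the derivatives of $u_i$.
   Context: All graphs are finite and simple. $N(u)$ is the neighborhood of $u$, $N[u]=N(u)\cup\{u\}$, and for a vertex set $W$, $N(W)=\bigcup_{w\in W}N(w)\setminus W$. For a vertex $u$ let $V_1,\ldots,V_\omega$ be the vertex sets of the connected components of $G\setminus N[u]$. $D_u(V_i)=\{V_p: N(V_p)\subseteq N(V_i)\}$; $V_i$ is a master component of $u$ if $|D_u(V_i)|\ge |D_u(V_j)|$ for all $j$; $D^*_u(V_i)=\{V_1,\ldots,V_\omega\}\setminus D_u(V_i)$; a component $V_j$ in a set $S$ of components is maximal in $S$ if there is no $V_l\in S$ with $N(V_j)\subsetneq N(V_l)$. Fix an arbitrary master component $V_i$ of $u$ and set $\delta_u=V_i$; if $D^*_u(V_i)=\emptyset$ set $\delta^*_u=\emptyset$, otherwise $\delta^*_u=V_j$ for an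 arbitrary maximal component $V_j$ of $D^*_u(V_i)$. Partition $N(u)$ into $N_0(u)$ (neighbors adjacent to no vertex of $\delta_u$ and no vertex of $\delta^*_u$), $N_1(u)$ (adjacent to $\delta_u$ but not to $\delta^*_u$), $N_2(u)$ (adjacent to $\delta^*_u$ but not to $\delta_u$), $N_{12}(u)$ (adjacent to both). Vertex splitting of $u$ (when $\delta^*_u\neq\emptyset$): $G^{\#}(u)$ has vertex set $V(G)\setminus\{u\}\cup\{u_1,u_2\}$ (new vertices, the derivatives of $u$), all edges of $G$ not incident to $u$, and the edges $u_1x$ for $x\in N_1(u)\cup N_{12}(u)$ and $u_2x$ for $x\in N_2(u)\cup N_{12}(u)$. In the procedure these notions are computed in the current graph $H_{i-1}$. Representations: $L_1,L_2$ are horizontal parallel lines; a permutation representation consists of segments ("lines") from $L_1$ to $L_2$ with distinct endpoints, the graph having lines as vertices, adjacent iff crossing. For a permutation representation $R$, $\theta_R(x)$ is the angle of line $x$ with $L_2$, and $\Phi_R$ orients each edge $xy$ from $x$ to $y$ iff $\theta_R(x)<\theta_R(y)$. If the $2n$ vertices of a permutation graph $P$ are grouped into $n$ pairs $\{w_i^1,w_i^2\}$, let $F_R$ be the directed graph on $\{w_1,\ldots,w_n\}$ obtained by merging each pair into $w_i$, with an arc $w_i\to w_j$ ($i\ne j$) whenever $\Phi_R$ has an arc from a member of pair $i$ to a member of pair $j$. $R$ is acyclic w.r.t. the pairs if $F_R$ has no directed cycle; $P$ is acyclic w.r.t. the pairs if it has such a representation. A trapezoid representation (trapezoids between $L_1$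 and $L_2$, all endpoints distinct, graph = intersection graph) is acyclic if the permutation representation formed by the left and right lines of all trapezoids is acyclic with respect to the pairs $\{$left line of $T_u$, right line of $T_u\}$; a trapezoid graph is acyclic if it has an acyclic trapezoid representation. *)

theory Defs
  imports "HOL-Analysis.Analysis"
begin

record 'a graph =
  verts :: "'a set"
  edges :: "'a set set"

definition finite_simple_graph :: "'a graph \<Rightarrow> bool" where
  "finite_simple_graph G \<longleftrightarrow>
     finite (verts G) \<and> (\<forall>e \<in> edges G. e \<subseteq> verts G \<and> card e = 2)"

definition induced :: "'a graph \<Rightarrow> 'a set \<Rightarrow> 'a graph" where
  "induced G W = \<lparr> verts = verts G \<inter> W, edges = {e \<in> edges G. e \<subseteq> W} \<rparr>"

definition nbh :: "'a graph \<Rightarrow> 'a \<Rightarrow> 'a set" where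
  "nbh G u = {x. {u, x} \<in> edges G}"

definition closed_nbh :: "'a graph \<Rightarrow> 'a \<Rightarrow> 'a set" where
  "closed_nbh G u = nbh G u \<union> {u}"

definition set_nbh :: "'a graph \<Rightarrow> 'a set \<Rightarrow> 'a set" where
  "set_nbh G W = (\<Union>w\<in>W. nbh G w) - W"

definition components :: "'a graph \<Rightarrow> 'a set set" where
  "components G = (\<lambda>x. {y \<in> verts G. (x, y) \<in> {(a, b). {a, b} \<in> edges G}\<^sup>*}) ` verts G"

definition comps_off :: "'a graph \<Rightarrow> 'a \<Rightarrow> 'a set set" where
  "comps_off G u = components (induced G (verts G - closed_nbh G u))"

definition D_set :: "'a graph \<Rightarrow> 'a \<Rightarrow> 'a set \<Rightarrow> 'a set set" where
  "D_set G u C = {C' \<in> comps_off G u. set_nbh G C' \<subseteq> set_nbh G C}"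

definition D_star :: "'a graph \<Rightarrow> 'a \<Rightarrow> 'a set \<Rightarrow> 'a set set" where
  "D_star G u C = comps_off G u - D_set G u C"

definition master_component :: "'a graph \<Rightarrow> 'a \<Rightarrow> 'a set \<Rightarrow> bool" where
  "master_component G u C \<longleftrightarrow> C \<in> comps_off G u \<and>
     (\<forall>C' \<in> comps_off G u. card (D_set G u C) \<ge> card (D_set G u C'))"

definition maximal_component :: "'a graph \<Rightarrow> 'a set set \<Rightarrow> 'a set \<Rightarrow> bool" where
  "maximal_component G S C \<longleftrightarrow> C \<in> S \<and> \<not> (\<exists>C' \<in> S. set_nbh G C \<subset> set_nbh G C')"

text \<open>\<open>delta_choice G u d ds\<close>: the pair \<open>(d, ds)\<close> is one of the admissible arbitrary choices of
  $(\delta_u, \delta^*_u)$ in \<open>G\<close>.\<close>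

definition delta_choice :: "'a graph \<Rightarrow> 'a \<Rightarrow> 'a set \<Rightarrow> 'a set \<Rightarrow> bool" where
  "delta_choice G u d ds \<longleftrightarrow> master_component G u d \<and>
     (if D_star G u d = {} then ds = {} else maximal_component G (D_star G u d) ds)"

definition adj_to_set :: "'a graph \<Rightarrow> 'a \<Rightarrow> 'a set \<Rightarrow> bool" where
  "adj_to_set G x W \<longleftrightarrow> (\<exists>w \<in> W. {x, w} \<in> edges G)"

definition N_1 :: "'a graph \<Rightarrow> 'a \<Rightarrow> 'a set \<Rightarrow> 'a set \<Rightarrow> 'a set" where
  "N_1 G u d ds = {x \<in> nbh G u. adj_to_set G x d \<and> \<not> adj_to_set G x ds}"

definition N_2 :: "'a graph \<Rightarrow> 'a \<Rightarrow> 'a set \<Rightarrow> 'a set \<Rightarrow> 'a set" where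
  "N_2 G u d ds = {x \<in> nbh G u. \<not> adj_to_set G x d \<and> adj_to_set G x ds}"

definition N_12 :: "'a graph \<Rightarrow> 'a \<Rightarrow> 'a set \<Rightarrow> 'a set \<Rightarrow> 'a set" where
  "N_12 G u d ds = {x \<in> nbh G u. adj_to_set G x d \<and> adj_to_set G x ds}"

text \<open>\<open>vertex_splitting G u u1 u2 H\<close>: for some admissible choice of $\delta_u$ and $\delta^*_u$ in
  \<open>G\<close>, the graph \<open>H\<close> is $G^{\#}(u)$, with the new vertices \<open>u1\<close> and \<open>u2\<close> as the derivatives of \<open>u\<close>.
  The case $\delta^*_u = \emptyset$, in which \<open>u2\<close> is isolated, is not excluded here: in an iterated
  splitting, $\delta^*_u \neq \emptyset$ in the initial graph does not guarantee
  $\delta^*_u \neq \emptyset$ in the graph in which \<open>u\<close> is eventually split.\<close>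

definition vertex_splitting :: "'a graph \<Rightarrow> 'a \<Rightarrow> 'a \<Rightarrow> 'a \<Rightarrow> 'a graph \<Rightarrow> bool" where
  "vertex_splitting G u u1 u2 H \<longleftrightarrow>
     u \<in> verts G \<and> u1 \<notin> verts G \<and> u2 \<notin> verts G \<and> u1 \<noteq> u2 \<and>
     (\<exists>d ds. delta_choice G u d ds \<and>
        H = \<lparr> verts = verts G - {u} \<union> {u1, u2},
              edges = {e \<in> edges G. u \<notin> e}
                \<union> {{u1, x} | x. x \<in> N_1 G u d ds \<union> N_12 G u d ds}
                \<union> {{u2, x} | x. x \<in> N_2 G u d ds \<union> N_12 G u d ds} \<rparr>)"

definition intersection_graph :: "'a set \<Rightarrow> ('a \<Rightarrow> 'b set) \<Rightarrow> 'a graph" where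
  "intersection_graph V S =
     \<lparr> verts = V, edges = {{x, y} | x y. x \<in> V \<and> y \<in> V \<and> x \<noteq> y \<and> S x \<inter> S y \<noteq> {}} \<rparr>"

text \<open>The plane is \<open>complex\<close>, with $L_1$ the line \<open>Im z = 1\<close> and $L_2$ the line \<open>Im z = 0\<close>. A
  segment between them is given by the abscissae of its endpoints on $L_1$ and on $L_2$.\<close>

type_synonym line = "real \<times> real"

definition top_pt :: "line \<Rightarrow> complex" where
  "top_pt l = Complex (fst l) 1"

definition bot_pt :: "line \<Rightarrow> complex" where
  "bot_pt l = Complex (snd l) 0"

definition seg :: "line \<Rightarrow> complex set" where
  "seg l = closed_segment (bot_pt l) (top_pt l)"

definition theta :: "line \<Rightarrow> real" where
  "theta l = Arg (top_pt l - bot_pt l)"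

definition distinct_endpoints :: "'a set \<Rightarrow> ('a \<Rightarrow> line) \<Rightarrow> bool" where
  "distinct_endpoints V R \<longleftrightarrow>
     inj_on (\<lambda>x. top_pt (R x)) V \<and> inj_on (\<lambda>x. bot_pt (R x)) V"

definition line_graph :: "'a set \<Rightarrow> ('a \<Rightarrow> line) \<Rightarrow> 'a graph" where
  "line_graph V R = intersection_graph V (\<lambda>x. seg (R x))"

definition permutation_rep :: "'a graph \<Rightarrow> ('a \<Rightarrow> line) \<Rightarrow> bool" where
  "permutation_rep P R \<longleftrightarrow>
     distinct_endpoints (verts P) R \<and> P = line_graph (verts P) R"

definition permutation_graph :: "'a graph \<Rightarrow> bool" where
  "permutation_graph P \<longleftrightarrow> finite_simple_graph P \<and> (\<exists>R. permutation_rep P R)"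

definition Phi :: "'a graph \<Rightarrow> ('a \<Rightarrow> line) \<Rightarrow> ('a \<times> 'a) set" where
  "Phi P R = {(x, y). {x, y} \<in> edges P \<and> theta (R x) < theta (R y)}"

text \<open>The pairs are \<open>{w1 i, w2 i}\<close> for \<open>i \<in> I\<close>; the merged vertex of such a pair is represented by
  its index \<open>i\<close>.\<close>

definition grouped_into_pairs :: "'a graph \<Rightarrow> 'i set \<Rightarrow> ('i \<Rightarrow> 'a) \<Rightarrow> ('i \<Rightarrow> 'a) \<Rightarrow> bool" where
  "grouped_into_pairs P I w1 w2 \<longleftrightarrow>
     inj_on w1 I \<and> inj_on w2 I \<and> w1 ` I \<inter> w2 ` I = {} \<and> w1 ` I \<union> w2 ` I = verts P"

definition merged_digraph ::
    "'a graph \<Rightarrow> ('a \<Rightarrow> line) \<Rightarrow> 'i set \<Rightarrow> ('i \<Rightarrow> 'a) \<Rightarrow> ('i \<Rightarrow> 'a) \<Rightarrow> ('i \<times> 'i) set" where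
  "merged_digraph P R I w1 w2 =
     {(i, j). i \<in> I \<and> j \<in> I \<and> i \<noteq> j \<and>
        (\<exists>x \<in> {w1 i, w2 i}. \<exists>y \<in> {w1 j, w2 j}. (x, y) \<in> Phi P R)}"

definition acyclic_permutation_rep ::
    "'a graph \<Rightarrow> ('a \<Rightarrow> line) \<Rightarrow> 'i set \<Rightarrow> ('i \<Rightarrow> 'a) \<Rightarrow> ('i \<Rightarrow> 'a) \<Rightarrow> bool" where
  "acyclic_permutation_rep P R I w1 w2 \<longleftrightarrow>
     permutation_rep P R \<and> grouped_into_pairs P I w1 w2 \<and>
     acyclic (merged_digraph P R I w1 w2)"

definition acyclic_permutation_graph ::
    "'a graph \<Rightarrow> 'i set \<Rightarrow> ('i \<Rightarrow> 'a) \<Rightarrow> ('i \<Rightarrow> 'a) \<Rightarrow> bool" where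
  "acyclic_permutation_graph P I w1 w2 \<longleftrightarrow>
     finite_simple_graph P \<and> (\<exists>R. acyclic_permutation_rep P R I w1 w2)"

datatype side = Left_Side | Right_Side

text \<open>A family of trapezoids is given by its left lines \<open>T (v, Left_Side)\<close> and its right lines
  \<open>T (v, Right_Side)\<close>.\<close>

definition trapezoid :: "('a \<times> side \<Rightarrow> line) \<Rightarrow> 'a \<Rightarrow> complex set" where
  "trapezoid T v = convex hull (seg (T (v, Left_Side)) \<union> seg (T (v, Right_Side)))"

definition trapezoid_rep :: "'a graph \<Rightarrow> ('a \<times> side \<Rightarrow> line) \<Rightarrow> bool" where
  "trapezoid_rep G T \<longleftrightarrow>
     distinct_endpoints (verts G \<times> UNIV) T \<and>
     (\<forall>v \<in> verts G. fst (T (v, Left_Side)) < fst (T (v, Right_Side)) \<and>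
                     snd (T (v, Left_Side)) < snd (T (v, Right_Side))) \<and>
     G = intersection_graph (verts G) (trapezoid T)"

definition trapezoid_graph :: "'a graph \<Rightarrow> bool" where
  "trapezoid_graph G \<longleftrightarrow> finite_simple_graph G \<and> (\<exists>T. trapezoid_rep G T)"

definition acyclic_trapezoid_rep :: "'a graph \<Rightarrow> ('a \<times> side \<Rightarrow> line) \<Rightarrow> bool" where
  "acyclic_trapezoid_rep G T \<longleftrightarrow>
     trapezoid_rep G T \<and>
     acyclic_permutation_rep (line_graph (verts G \<times> UNIV) T) T
       (verts G) (\<lambda>v. (v, Left_Side)) (\<lambda>v. (v, Right_Side))"

definition acyclic_trapezoid_graph :: "'a graph \<Rightarrow> bool" where
  "acyclic_trapezoid_graph G \<longleftrightarrow>
     finite_simple_graph G \<and> (\<exists>T. acyclic_trapezoid_rep G T)"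

end

theory Submission
  imports Defs
begin

text \<open>
  Fix a trapezoid representation. A component of \<open>G \ N[u]\<close> lies entirely to the left or entirely to
  the right of the trapezoid of \<open>u\<close>, and the component nearest to \<open>u\<close> on a side has the largest
  neighbourhood among those of its side. Hence \<open>N(\<delta>)\<close> consists of the neighbours of \<open>u\<close> that
  meet something on one side of \<open>u\<close>, and \<open>N(\<delta>*)\<close>, if \<open>\<delta>*\<close> is not empty, of those that meet
  something on the other side. A line squeezed between everything left of \<open>u\<close> and the trapezoids of
  \<open>u\<close> and of its neighbours that reach nothing on the left crosses exactly those
  neighbours that do reach something on the left, so \<open>u\<close> can be replaced by two lines without moving any other trapezoid.

  For acyclicity, if derivatives of \<open>u\<close> and \<open>v\<close> cross in the resulting representation, then the sides
  of the original trapezoids which they replace already cross, in the same direction. So the merged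
  digraph of the derivatives embeds into that of the original representation.
\<close>

section \<open>Segments and trapezoids\<close>

definition left_of :: "line \<Rightarrow> line \<Rightarrow> bool" (infix "\<lless>" 50) where
  "l \<lless> m \<longleftrightarrow> fst l < fst m \<and> snd l < snd m"

text \<open>Crossing with a direction: \<open>l\<close> starts to the left of \<open>m\<close> on
  the lower line and ends to its right on the upper one, so its angle is the smaller and
  \<open>Phi\<close> orients the edge from \<open>l\<close> to \<open>m\<close>.\<close>

definition cuts :: "line \<Rightarrow> line \<Rightarrow> bool" where
  "cuts l m \<longleftrightarrow> fst m < fst l \<and> snd l < snd m"

definition abscissa :: "line \<Rightarrow> real \<Rightarrow> real" where
  "abscissa l t = (1 - t) * snd l + t * fst l"

text \<open>The degenerate case \<open>strip l l\<close> is the segment itself, so lines and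
  trapezoids share one formalism.\<close>

definition strip :: "line \<Rightarrow> line \<Rightarrow> complex set" where
  "strip l r = {z. 0 \<le> Im z \<and> Im z \<le> 1 \<and>
     abscissa l (Im z) \<le> Re z \<and> Re z \<le> abscissa r (Im z)}"

lemma abscissa_mono:
  assumes "fst l \<le> fst r" "snd l \<le> snd r" "0 \<le> t" "t \<le> 1"
  shows "abscissa l t \<le> abscissa r t"
  unfolding abscissa_def using assms by (intro add_mono mult_left_mono) auto

lemma seg_eq_strip: "seg l = strip l l"
proof
  show "seg l \<subseteq> strip l l"
    by (auto simp: seg_def strip_def abscissa_def in_segment top_pt_def bot_pt_def)
  show "strip l l \<subseteq> seg l"
    by (auto simp: seg_def strip_def abscissa_def in_segment top_pt_def bot_pt_def complex_eq_iff)
qed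

lemma convex_strip: "convex (strip l r)"
proof -
  have eq: "strip l r = {z. 0 \<le> inner \<i> z} \<inter> {z. inner \<i> z \<le> 1} \<inter>
      {z. inner (Complex 1 (snd l - fst l)) z \<ge> snd l} \<inter>
      {z. inner (Complex 1 (snd r - fst r)) z \<le> snd r}"
    by (auto simp: strip_def abscissa_def inner_complex_def algebra_simps)
  show ?thesis unfolding eq
    by (intro convex_Int convex_halfspace_ge convex_halfspace_le)
qed

text \<open>At each height the strip is a horizontal segment from a point of \<open>seg l\<close> to
  a point of \<open>seg r\<close>, and the convex hull contains such segments.\<close>

lemma convex_hull_segs_eq_strip:
  assumes "fst l \<le> fst r" "snd l \<le> snd r"
  shows "convex hull (seg l \<union> seg r) = strip l r"
proof
  show "convex hull (seg l \<union> seg r) \<subseteq> strip l r"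
  proof (rule hull_minimal)
    show "seg l \<union> seg r \<subseteq> strip l r"
      unfolding seg_eq_strip using abscissa_mono[OF assms] by (fastforce simp: strip_def)
  qed (rule convex_strip)
  show "strip l r \<subseteq> convex hull (seg l \<union> seg r)"
  proof
    fix z assume z: "z \<in> strip l r"
    define t where "t = Im z"
    define p where "p = Complex (abscissa l t) t"
    define q where "q = Complex (abscissa r t) t"
    have pq: "p \<in> seg l" "q \<in> seg r"
      using z by (auto simp: seg_eq_strip strip_def p_def q_def t_def)
    have "z \<in> closed_segment p q"
    proof -
      have "Re z \<in> closed_segment (abscissa l t) (abscissa r t)"
        using z by (auto simp: strip_def t_def closed_segment_eq_real_ivl)
      then show ?thesis
        by (auto simp: in_segment p_def q_def t_def complex_eq_iff algebra_simps)
    qed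
    also have "closed_segment p q \<subseteq> convex hull (seg l \<union> seg r)"
      using pq by (intro closed_segment_subset) (auto simp: hull_inc)
    finally show "z \<in> convex hull (seg l \<union> seg r)" .
  qed
qed

section \<open>Intersecting strips\<close>

lemma strips_meet_if_height:
  assumes "fst l \<le> fst r" "snd l \<le> snd r" "fst l' \<le> fst r'" "snd l' \<le> snd r'"
    and "0 \<le> t" "t \<le> 1" "abscissa l' t \<le> abscissa r t" "abscissa l t \<le> abscissa r' t"
  shows "strip l r \<inter> strip l' r' \<noteq> {}"
proof -
  \<comment> \<open>The larger of the two left bounds at height \<open>t\<close> lies in both
    horizontal sections.\<close>
  have "Complex (max (abscissa l t) (abscissa l' t)) t \<in> strip l r \<inter> strip l' r'"
    using assms abscissa_mono[of l r t] abscissa_mono[of l' r' t] by (auto simp: strip_def)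
  then show ?thesis by blast
qed

lemma affine_zero:
  fixes a b :: real
  assumes "0 \<le> a" "b < 0"
  obtains t where "0 \<le> t" "t \<le> 1" "(1 - t) * a + t * b = 0"
proof
  show "0 \<le> a / (a - b)" "a / (a - b) \<le> 1" using assms by auto
  show "(1 - a / (a - b)) * a + a / (a - b) * b = 0"
    using assms by (simp add: field_simps)
qed

text \<open>The differences between the right bound of one strip and the left bound of the other are
  affine in the height. Their sum is the total width of both strips, hence never negative; so at a
  zero of one the other is nonnegative, and the strips meet at that height.\<close>

lemma strips_meet_iff:
  assumes le: "fst l \<le> fst r" "snd l \<le> snd r" "fst l' \<le> fst r'" "snd l' \<le> snd r'"
  shows "strip l r \<inter> strip l' r' \<noteq> {} \<longleftrightarrow> \<not> r \<lless> l' \<and> \<not> r' \<lless> l"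
proof
  have less: "abscissa a t < abscissa b t" if "a \<lless> b" "0 \<le> t" "t \<le> 1" for a b t
  proof (cases "t = 0")
    case False
    then have "(1 - t) * snd a \<le> (1 - t) * snd b" "t * fst a < t * fst b"
      using that by (auto simp: left_of_def intro: mult_left_mono)
    then show ?thesis by (simp add: abscissa_def)
  qed (use that in \<open>auto simp: abscissa_def left_of_def\<close>)
  assume "strip l r \<inter> strip l' r' \<noteq> {}"
  then show "\<not> r \<lless> l' \<and> \<not> r' \<lless> l"
    using less[of r l'] less[of r' l] by (fastforce simp: strip_def)
next
  assume n: "\<not> r \<lless> l' \<and> \<not> r' \<lless> l"
  note meet = strips_meet_if_height[OF le]
  let ?f = "\<lambda>t. abscissa r t - abscissa l' t" and ?g = "\<lambda>t. abscissa r' t - abscissa l t"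
  have f: "?f t = (1 - t) * ?f 0 + t * ?f 1" and g: "?g t = (1 - t) * ?g 0 + t * ?g 1" for t
    by (simp_all add: abscissa_def algebra_simps)
  have fg: "0 \<le> ?f t + ?g t" if "0 \<le> t" "t \<le> 1" for t
    using abscissa_mono[OF le(1,2) that] abscissa_mono[OF le(3,4) that] by simp
  have ends: "0 \<le> ?f 0 \<or> 0 \<le> ?f 1" "0 \<le> ?g 0 \<or> 0 \<le> ?g 1"
    using n by (auto simp: abscissa_def left_of_def)
  have "\<exists>t. 0 \<le> t \<and> t \<le> 1 \<and> 0 \<le> ?f t \<and> 0 \<le> ?g t"
  proof (cases "(0 \<le> ?f 0 \<and> 0 \<le> ?g 0) \<or> (0 \<le> ?f 1 \<and> 0 \<le> ?g 1)")
    case True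
    then show ?thesis by (meson order_refl zero_le_one)
  next
    case False
    \<comment> \<open>Neither end works, so each function is nonnegative at exactly one end, and the
      two at opposite ends. The one that is nonnegative at the lower end is followed to its
      zero.\<close>
    then consider "0 \<le> ?f 0" "?f 1 < 0" | "0 \<le> ?g 0" "?g 1 < 0" using ends by linarith
    then show ?thesis
    proof cases
      case 1
      then obtain t where "0 \<le> t" "t \<le> 1" "?f t = 0" using f affine_zero by metis
      then show ?thesis using fg[of t] by (intro exI[of _ t]) auto
    next
      case 2
      then obtain t where "0 \<le> t" "t \<le> 1" "?g t = 0" using g affine_zero by metis
      then show ?thesis using fg[of t] by (intro exI[of _ t]) auto
    qed
  qed
  then show "strip l r \<inter> strip l' r' \<noteq> {}" using meet by fastforce
qed

text \<open>The line rises by 1 over the run \<open>fst l - snd l\<close>, so its angle is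
  \<open>pi / 2\<close> minus the arctangent of the run, which strictly decreases as the run
  grows.\<close>

lemma theta_less_iff: "theta l < theta m \<longleftrightarrow> fst m - snd m < fst l - snd l"
proof -
  have Arg: "Arg (Complex x 1) = pi / 2 - arctan x" for x
  proof -
    have "Complex x 1 = rcis (sqrt (1 + x\<^sup>2)) (pi / 2 - arctan x)"
      by (simp add: complex_eq_iff cos_diff sin_diff sin_arctan cos_arctan
          real_sqrt_eq_zero_cancel_iff sum_power2_eq_zero_iff add_nonneg_eq_0_iff)
    moreover have "pi / 2 - arctan x \<in> {-pi<..pi}"
      using arctan_lbound[of x] arctan_ubound[of x] pi_gt_zero by (auto simp: field_simps)
    moreover have "sqrt (1 + x\<^sup>2) > 0" by (simp add: add_pos_nonneg)
    ultimately show ?thesis by (simp add: Arg_rcis)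
  qed
  show ?thesis
    by (simp add: theta_def top_pt_def bot_pt_def Arg complex_diff arctan_less_iff)
qed

section \<open>Components of the complement of a closed neighbourhood\<close>

definition meet :: "('a \<Rightarrow> line) \<Rightarrow> ('a \<Rightarrow> line) \<Rightarrow> 'a \<Rightarrow> 'a \<Rightarrow> bool" where
  "meet lf rt v w \<longleftrightarrow> \<not> rt v \<lless> lf w \<and> \<not> rt w \<lless> lf v"

lemma meet_commute: "meet lf rt v w \<longleftrightarrow> meet lf rt w v"
  by (auto simp: meet_def)

lemma left_of_trans: "a \<lless> b \<Longrightarrow> b \<lless> c \<Longrightarrow> a \<lless> c"
  by (auto simp: left_of_def)

text \<open>Negation reflects the plane left to right: with \<open>lf\<close> and \<open>rt\<close>
  exchanged it preserves \<open>meet\<close>, and it reverses the direction of crossings. One-sided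
  arguments below are transferred to the other side in this way.\<close>

lemma uminus_left_of_uminus [simp]: "- l \<lless> - m \<longleftrightarrow> m \<lless> l"
  by (auto simp: left_of_def)

lemma cuts_uminus [simp]: "cuts (- l) (- m) \<longleftrightarrow> cuts m l"
  by (auto simp: cuts_def)

lemma meet_mirror [simp]: "meet (\<lambda>v. - rt v) (\<lambda>v. - lf v) v w \<longleftrightarrow> meet lf rt v w"
  by (auto simp: meet_def)

text \<open>By \<open>strips_meet_iff\<close> this covers trapezoid graphs and, when
  \<open>lf\<close> and \<open>rt\<close> agree, permutation graphs, in terms of endpoints
  alone.\<close>

definition strip_graph :: "'a set \<Rightarrow> ('a \<Rightarrow> line) \<Rightarrow> ('a \<Rightarrow> line) \<Rightarrow> 'a graph" where
  "strip_graph V lf rt =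
     \<lparr> verts = V, edges = {{v, w} | v w. v \<in> V \<and> w \<in> V \<and> v \<noteq> w \<and> meet lf rt v w} \<rparr>"

lemma verts_strip_graph [simp]: "verts (strip_graph V lf rt) = V"
  by (simp add: strip_graph_def)

lemma strip_graph_edge_iff [simp]:
  "{v, w} \<in> edges (strip_graph V lf rt) \<longleftrightarrow> v \<in> V \<and> w \<in> V \<and> v \<noteq> w \<and> meet lf rt v w"
  by (auto simp: strip_graph_def doubleton_eq_iff meet_commute)

lemma strip_graph_mirror: "strip_graph V (\<lambda>v. - rt v) (\<lambda>v. - lf v) = strip_graph V lf rt"
  by (simp add: strip_graph_def)

lemma edges_strip_graphE:
  assumes "e \<in> edges (strip_graph V lf rt)"
  obtains v w where "e = {v, w}" "v \<in> V" "w \<in> V" "v \<noteq> w" "meet lf rt v w"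
  using assms by (auto simp: strip_graph_def)

lemma finite_simple_strip_graph: "finite V \<Longrightarrow> finite_simple_graph (strip_graph V lf rt)"
  by (auto simp: finite_simple_graph_def elim!: edges_strip_graphE)

lemma induced_strip_graph: "induced (strip_graph V lf rt) W = strip_graph (V \<inter> W) lf rt"
  by (auto simp: induced_def strip_graph_def)

section \<open>Reachability outside a closed neighbourhood\<close>

lemma comps_off_eq:
  "comps_off G u = (\<lambda>x. {y \<in> verts G - closed_nbh G u.
     (x, y) \<in> {(a, b). {a, b} \<in> edges G \<and> {a, b} \<subseteq> verts G - closed_nbh G u}\<^sup>*})
       ` (verts G - closed_nbh G u)"
proof -
  have "verts (induced G (verts G - closed_nbh G u)) = verts G - closed_nbh G u"
    by (auto simp: induced_def)
  moreover have "{a, b} \<in> edges (induced G (verts G - closed_nbh G u)) \<longleftrightarrow>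
      {a, b} \<in> edges G \<and> {a, b} \<subseteq> verts G - closed_nbh G u" for a b
    by (simp add: induced_def)
  ultimately show ?thesis
    unfolding comps_off_def components_def by presburger
qed

lemma comps_offE:
  assumes "C \<in> comps_off G u"
  obtains x where "x \<in> verts G - closed_nbh G u"
    "C = {y \<in> verts G - closed_nbh G u.
            (x, y) \<in> {(a, b). {a, b} \<in> edges G \<and> {a, b} \<subseteq> verts G - closed_nbh G u}\<^sup>*}"
  using assms unfolding comps_off_eq by (rule imageE)

lemma comps_off_covers:
  assumes "v \<in> verts G - closed_nbh G u"
  obtains C where "C \<in> comps_off G u" "v \<in> C"
proof
  show "{y \<in> verts G - closed_nbh G u.
     (v, y) \<in> {(a, b). {a, b} \<in> edges G \<and> {a, b} \<subseteq> verts G - closed_nbh G u}\<^sup>*} \<in> comps_off G u"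
    unfolding comps_off_eq using assms by (rule imageI)
qed (use assms in auto)

lemma finite_comps_off: "finite (verts G) \<Longrightarrow> finite (comps_off G u)"
  by (simp add: comps_off_def components_def induced_def)

lemma comps_off_subset: "C \<in> comps_off G u \<Longrightarrow> C \<subseteq> verts G - closed_nbh G u"
  by (erule comps_offE) auto

lemma comps_off_nonempty: "C \<in> comps_off G u \<Longrightarrow> C \<noteq> {}"
  by (erule comps_offE) auto

lemma comps_off_closed:
  assumes "C \<in> comps_off G u" "c \<in> C" "x \<in> verts G - closed_nbh G u" "{c, x} \<in> edges G"
  shows "x \<in> C"
  using assms by (elim comps_offE) (auto intro: rtrancl_into_rtrancl)

text \<open>A property that no edge off \<open>N[u]\<close> changes is carried along paths. It is
  applied to the property of lying left of \<open>u\<close>.\<close>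

lemma comps_off_constant:
  assumes "C \<in> comps_off G u" "c \<in> C" "c' \<in> C"
    and step: "\<And>a b. \<lbrakk>a \<in> verts G - closed_nbh G u; b \<in> verts G - closed_nbh G u;
      {a, b} \<in> edges G\<rbrakk> \<Longrightarrow> P a \<longleftrightarrow> P b"
  shows "P c \<longleftrightarrow> P c'"
proof -
  let ?E = "{(a, b). {a, b} \<in> edges G \<and> {a, b} \<subseteq> verts G - closed_nbh G u}"
  obtain x where x: "(x, c) \<in> ?E\<^sup>*" "(x, c') \<in> ?E\<^sup>*"
    using assms(1-3) by (elim comps_offE) auto
  have "P x \<longleftrightarrow> P y" if "(x, y) \<in> ?E\<^sup>*" for y
    using that by (induction rule: rtrancl_induct) (use step in auto)
  then show ?thesis using x by blast
qed

text \<open>A neighbour of \<open>C\<close> off \<open>N[u]\<close> would belong to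
  \<open>C\<close>, and \<open>u\<close> itself has no neighbour in \<open>C\<close>; only vertices
  of \<open>N(u)\<close> remain.\<close>

lemma set_nbh_comps_off:
  assumes "finite_simple_graph G" "C \<in> comps_off G u"
  shows "set_nbh G C = {x \<in> nbh G u. adj_to_set G x C}"
proof
  have sub: "C \<subseteq> verts G - closed_nbh G u" by (rule comps_off_subset[OF assms(2)])
  show "set_nbh G C \<subseteq> {x \<in> nbh G u. adj_to_set G x C}"
  proof
    fix x assume "x \<in> set_nbh G C"
    then obtain c where c: "c \<in> C" "{c, x} \<in> edges G" "x \<notin> C"
      by (auto simp: set_nbh_def nbh_def)
    then have "x \<in> verts G" "x \<noteq> u"
      using assms(1) sub by (auto simp: finite_simple_graph_def closed_nbh_def nbh_def insert_commute)
    moreover have "x \<in> closed_nbh G u"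
      using comps_off_closed[OF assms(2) c(1) _ c(2)] c(3) \<open>x \<in> verts G\<close> by blast
    ultimately have "x \<in> nbh G u" by (simp add: closed_nbh_def)
    then show "x \<in> {x \<in> nbh G u. adj_to_set G x C}"
      using c by (auto simp: adj_to_set_def insert_commute)
  qed
  show "{x \<in> nbh G u. adj_to_set G x C} \<subseteq> set_nbh G C"
    using sub by (auto simp: set_nbh_def nbh_def adj_to_set_def closed_nbh_def insert_commute)
qed

text \<open>The order is weak, and distinctness is required only between different vertices, so that
  a derivative may be a single line with \<open>lf\<close> equal to \<open>rt\<close>.\<close>

locale strip_rep =
  fixes V :: "'a set" and lf rt :: "'a \<Rightarrow> line"
  assumes finite_V: "finite V"
    and lf_le_rt: "v \<in> V \<Longrightarrow> fst (lf v) \<le> fst (rt v) \<and> snd (lf v) \<le> snd (rt v)"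
    and endpoints_differ: "\<lbrakk>v \<in> V; w \<in> V; v \<noteq> w; l \<in> {lf v, rt v}; m \<in> {lf w, rt w}\<rbrakk> \<Longrightarrow>
      fst l \<noteq> fst m \<and> snd l \<noteq> snd m"
begin

lemma mirror: "strip_rep V (\<lambda>v. - rt v) (\<lambda>v. - lf v)"
proof
  fix v w l m
  assume vw: "v \<in> V" "w \<in> V" "v \<noteq> w" "l \<in> {- rt v, - lf v}" "m \<in> {- rt w, - lf w}"
  then have "- l \<in> {lf v, rt v}" "- m \<in> {lf w, rt w}" by auto
  from endpoints_differ[OF vw(1-3) this] show "fst l \<noteq> fst m \<and> snd l \<noteq> snd m" by auto
qed (use finite_V lf_le_rt in auto)

lemma left_of_trans_via:
  assumes "v \<in> V" "rt a \<lless> lf v" "rt v \<lless> lf b"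
  shows "rt a \<lless> lf b"
  using assms lf_le_rt[of v] by (auto simp: left_of_def)

lemma not_left_ofD:
  assumes "\<not> rt v \<lless> lf w" "v \<in> V" "w \<in> V" "v \<noteq> w"
  shows "fst (lf w) < fst (rt v) \<or> snd (lf w) < snd (rt v)"
  using endpoints_differ[of v w "rt v" "lf w"] assms by (auto simp: left_of_def)

abbreviation "adj \<equiv> meet lf rt"

abbreviation "G \<equiv> strip_graph V lf rt"

section \<open>The two sides of a vertex\<close>

lemma nbh_iff: "x \<in> nbh G u \<longleftrightarrow> u \<in> V \<and> x \<in> V \<and> x \<noteq> u \<and> adj u x"
  by (auto simp: nbh_def)

lemma off_iff:
  assumes "u \<in> V"
  shows "v \<in> verts G - closed_nbh G u \<longleftrightarrow> v \<in> V \<and> (rt v \<lless> lf u \<or> rt u \<lless> lf v)"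
  using assms lf_le_rt[OF assms] by (auto simp: closed_nbh_def nbh_iff meet_def left_of_def)

text \<open>The strip of \<open>u\<close> separates its two sides, so adjacent vertices off
  \<open>N[u]\<close> lie on the same side.\<close>

lemma comps_off_side:
  assumes "u \<in> V" "C \<in> comps_off G u" "c \<in> C" "c' \<in> C" "rt c \<lless> lf u"
  shows "rt c' \<lless> lf u"
proof -
  have "rt a \<lless> lf u \<longleftrightarrow> rt b \<lless> lf u"
    if "a \<in> verts G - closed_nbh G u" "b \<in> verts G - closed_nbh G u" "{a, b} \<in> edges G" for a b
    using that left_of_trans_via[OF \<open>u \<in> V\<close>, of a b] left_of_trans_via[OF \<open>u \<in> V\<close>, of b a]
    unfolding off_iff[OF \<open>u \<in> V\<close>] by (auto simp: meet_def)
  from comps_off_constant[OF assms(2-4), of "\<lambda>c. rt c \<lless> lf u", OF this] assms(5)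
  show ?thesis by blast
qed

text \<open>The component containing the left vertex with the rightmost upper endpoint separates \<open>u\<close>
  from all other components on the left.\<close>

lemma nearest_left_component:
  assumes u: "u \<in> V" and v: "v \<in> V" "rt v \<lless> lf u"
  obtains L where "L \<in> comps_off G u" "\<forall>c\<in>L. rt c \<lless> lf u"
    "\<And>c x. \<lbrakk>c \<in> V; rt c \<lless> lf u; x \<in> nbh G u; adj c x\<rbrakk> \<Longrightarrow> adj_to_set G x L"
proof -
  let ?A = "{a \<in> V. rt a \<lless> lf u}"
  have "finite ?A" "?A \<noteq> {}" using finite_V v by auto
  then obtain v0 where v0A: "v0 \<in> ?A" "Max ((\<lambda>a. fst (rt a)) ` ?A) = fst (rt v0)"
    by (rule obtains_MAX)
  then have v0: "v0 \<in> ?A" "\<And>a. a \<in> ?A \<Longrightarrow> fst (rt a) \<le> fst (rt v0)"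
    using \<open>finite ?A\<close> by (metis (no_types, lifting) Max_ge finite_imageI imageI)+
  then have "v0 \<in> verts G - closed_nbh G u" unfolding off_iff[OF u] by simp
  then obtain L where L: "L \<in> comps_off G u" "v0 \<in> L" by (rule comps_off_covers)
  have left: "\<forall>c\<in>L. rt c \<lless> lf u" using comps_off_side[OF u L] v0 by blast
  have "adj_to_set G x L" if c: "c \<in> V" "rt c \<lless> lf u" and x: "x \<in> nbh G u" "adj c x" for c x
  proof (rule ccontr)
    \<comment> \<open>Such an \<open>x\<close> lies right of \<open>v0\<close>. As
      \<open>rt c\<close> does not pass \<open>rt v0\<close> on the upper line, it must pass
      \<open>lf x\<close> on the lower one; then \<open>c\<close> meets \<open>v0\<close> and so
      belongs to \<open>L\<close>.\<close>
    assume no: "\<not> adj_to_set G x L"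
    have xV: "x \<in> V" "x \<noteq> u" "adj u x" using x by (auto simp: nbh_iff)
    have LV: "L \<subseteq> V" using comps_off_subset[OF L(1)] by auto
    \<comment> \<open>If \<open>x\<close> were left of a vertex that is itself left of
      \<open>u\<close>, it could not meet \<open>u\<close>.\<close>
    have disj: "\<not> rt x \<lless> lf a" if "a \<in> V" "rt a \<lless> lf u" for a
      using left_of_trans_via[OF that(1), of x u] that xV by (auto simp: meet_def)
    have "x \<noteq> a" if "a \<in> V" "rt a \<lless> lf u" for a using xV that by (auto simp: meet_def)
    then have "x \<noteq> v0" "x \<noteq> c" using v0 c by blast+
    have "\<not> adj x v0" using no L(2) xV LV \<open>x \<noteq> v0\<close> by (auto simp: adj_to_set_def)
    then have v0x: "rt v0 \<lless> lf x" using disj v0 by (auto simp: meet_def)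
    have "fst (rt c) \<le> fst (rt v0)" using v0 c by blast
    have "snd (lf x) < snd (rt c)"
      using not_left_ofD[of c x] x(2) c xV \<open>x \<noteq> c\<close> v0x \<open>fst (rt c) \<le> fst (rt v0)\<close>
      by (auto simp: meet_def left_of_def)
    then have "adj v0 c"
      using v0x \<open>fst (rt c) \<le> fst (rt v0)\<close> lf_le_rt[of c] lf_le_rt[of v0] v0(1) c
      by (auto simp: meet_def left_of_def)
    moreover have "v0 \<noteq> c" using \<open>snd (lf x) < snd (rt c)\<close> v0x by (auto simp: left_of_def)
    ultimately have "{v0, c} \<in> edges G" using v0(1) c by simp
    moreover have "c \<in> verts G - closed_nbh G u" unfolding off_iff[OF u] using c by simp
    ultimately have "c \<in> L" using comps_off_closed[OF L] by blast
    then show False using no x(2) xV c \<open>x \<noteq> c\<close> by (auto simp: adj_to_set_def meet_commute)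
  qed
  with L left that show thesis by blast
qed

text \<open>Let \<open>L\<close> be the nearest component on the left. Its neighbourhood contains
  that of \<open>d\<close>, so its \<open>D_set\<close> contains that of \<open>d\<close>; as
  \<open>d\<close> is a master component, the two sets coincide, \<open>L\<close> is in the
  \<open>D_set\<close> of \<open>d\<close>, and the neighbourhoods agree. A nonempty
  \<open>ds\<close> on the left would lie in the \<open>D_set\<close> of \<open>d\<close> too. So it
  lies on the right, where maximality in \<open>D_star\<close> gives it the neighbourhood of the
  nearest component.\<close>

lemma delta_nbh_if_left:
  assumes u: "u \<in> V" and d: "delta_choice G u d ds" and left: "\<exists>c\<in>d. rt c \<lless> lf u"
  shows "{x \<in> nbh G u. adj_to_set G x d} = {x \<in> nbh G u. \<exists>a\<in>V. rt a \<lless> lf u \<and> adj a x}"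
    and "ds = {} \<or>
      {x \<in> nbh G u. adj_to_set G x ds} = {x \<in> nbh G u. \<exists>a\<in>V. rt u \<lless> lf a \<and> adj a x}"
proof -
  let ?N = "\<lambda>C. {x \<in> nbh G u. adj_to_set G x C}"
  let ?NL = "{x \<in> nbh G u. \<exists>a\<in>V. rt a \<lless> lf u \<and> adj a x}"
  let ?NR = "{x \<in> nbh G u. \<exists>a\<in>V. rt u \<lless> lf a \<and> adj a x}"
  note N = set_nbh_comps_off[OF finite_simple_strip_graph[OF finite_V]]
  have dC: "d \<in> comps_off G u" and master: "\<And>C. C \<in> comps_off G u \<Longrightarrow> card (D_set G u C) \<le> card (D_set G u d)"
    using d by (auto simp: delta_choice_def master_component_def)
  have dsub: "d \<subseteq> V" using comps_off_subset[OF dC] by auto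
  have fin: "finite (D_set G u C)" for C
    using finite_comps_off[of G u] finite_V by (simp add: D_set_def)
  have NL: "?N C \<subseteq> ?NL" if "C \<in> comps_off G u" "\<forall>c\<in>C. rt c \<lless> lf u" for C
    using that by (auto simp: adj_to_set_def meet_commute)
  have NR: "?N C \<subseteq> ?NR" if "C \<in> comps_off G u" "\<forall>c\<in>C. rt u \<lless> lf c" for C
    using that by (auto simp: adj_to_set_def meet_commute)
  have dleft: "\<forall>c\<in>d. rt c \<lless> lf u" using left comps_off_side[OF u dC] by blast
  obtain v where v: "v \<in> V" "rt v \<lless> lf u" using left dsub by blast
  obtain L where L: "L \<in> comps_off G u" "\<forall>c\<in>L. rt c \<lless> lf u"
    "\<And>c x. \<lbrakk>c \<in> V; rt c \<lless> lf u; x \<in> nbh G u; adj c x\<rbrakk> \<Longrightarrow> adj_to_set G x L"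
    using nearest_left_component[OF u v] by blast
  have NL_L: "?N L = ?NL" using NL[OF L(1,2)] L(3) by blast
  have "set_nbh G d \<subseteq> set_nbh G L" using N[OF dC] N[OF L(1)] NL_L NL[OF dC dleft] by simp
  then have "D_set G u d \<subseteq> D_set G u L" by (auto simp: D_set_def)
  then have "D_set G u d = D_set G u L"
    using fin master[OF L(1)] by (metis card_subset_eq card_mono le_antisym)
  moreover have "L \<in> D_set G u L" using L(1) by (simp add: D_set_def)
  ultimately have "L \<in> D_set G u d" by blast
  then have "set_nbh G L \<subseteq> set_nbh G d" by (simp add: D_set_def)
  then show *: "?N d = ?NL" using N[OF dC] N[OF L(1)] NL_L NL[OF dC dleft] by simp
  show "ds = {} \<or> ?N ds = ?NR"
  proof (cases "D_star G u d = {}")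
    case True
    then show ?thesis using d by (simp add: delta_choice_def)
  next
    case False
    then have ds: "ds \<in> D_star G u d"
      and maxi: "\<And>C. C \<in> D_star G u d \<Longrightarrow> \<not> set_nbh G ds \<subset> set_nbh G C"
      using d by (auto simp: delta_choice_def maximal_component_def)
    have dsC: "ds \<in> comps_off G u" and nsub: "\<not> set_nbh G ds \<subseteq> set_nbh G d"
      using ds by (auto simp: D_star_def D_set_def)
    have dssub: "ds \<subseteq> V" using comps_off_subset[OF dsC] by auto
    have "\<not> (\<exists>c\<in>ds. rt c \<lless> lf u)"
    proof
      assume "\<exists>c\<in>ds. rt c \<lless> lf u"
      then have "\<forall>c\<in>ds. rt c \<lless> lf u" using comps_off_side[OF u dsC] by blast
      from NL[OF dsC this] show False using nsub * N[OF dsC] N[OF dC] by simp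
    qed
    then have dsright: "\<forall>c\<in>ds. rt u \<lless> lf c"
      using comps_off_subset[OF dsC] off_iff[OF u] by blast
    then obtain w where w: "w \<in> V" "rt u \<lless> lf w" using comps_off_nonempty[OF dsC] dssub by blast
    interpret m: strip_rep V "\<lambda>v. - rt v" "\<lambda>v. - lf v" by (rule mirror)
    obtain R where R: "R \<in> comps_off G u" "\<forall>c\<in>R. rt u \<lless> lf c"
      "\<And>c x. \<lbrakk>c \<in> V; rt u \<lless> lf c; x \<in> nbh G u; adj c x\<rbrakk> \<Longrightarrow> adj_to_set G x R"
      using m.nearest_left_component[OF u, of w] w unfolding strip_graph_mirror by auto
    have NR_R: "?N R = ?NR" using NR[OF R(1,2)] R(3) by blast
    have sub: "set_nbh G ds \<subseteq> set_nbh G R" using N[OF dsC] N[OF R(1)] NR_R NR[OF dsC dsright] by simp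
    then have "R \<in> D_star G u d" using R(1) nsub by (auto simp: D_star_def D_set_def)
    then have "set_nbh G ds = set_nbh G R" using maxi sub by blast
    then show ?thesis using N[OF dsC] N[OF R(1)] NR_R by simp
  qed
qed

text \<open>If \<open>d\<close> is on the right, the previous lemma is used in the reflected
  representation. The alternative \<open>N ds = {}\<close> covers an empty \<open>ds\<close>, which
  can occur in the course of the iteration.\<close>

lemma delta_nbh:
  assumes u: "u \<in> V" and d: "delta_choice G u d ds"
  defines "N \<equiv> \<lambda>C. {x \<in> nbh G u. adj_to_set G x C}"
    and "NL \<equiv> {x \<in> nbh G u. \<exists>a\<in>V. rt a \<lless> lf u \<and> adj a x}"
    and "NR \<equiv> {x \<in> nbh G u. \<exists>a\<in>V. rt u \<lless> lf a \<and> adj a x}"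
  shows "N d = NL \<and> (N ds = {} \<or> N ds = NR) \<or> N d = NR \<and> (N ds = {} \<or> N ds = NL)"
proof -
  have dC: "d \<in> comps_off G u" using d by (auto simp: delta_choice_def master_component_def)
  have empty: "N {} = {}" by (simp add: N_def adj_to_set_def)
  obtain c where c: "c \<in> d" using comps_off_nonempty[OF dC] by blast
  then have "rt c \<lless> lf u \<or> rt u \<lless> lf c" using comps_off_subset[OF dC] off_iff[OF u] by blast
  then show ?thesis
  proof
    assume "rt c \<lless> lf u"
    then show ?thesis using delta_nbh_if_left[OF u d] c empty unfolding N_def NL_def NR_def by blast
  next
    assume r: "rt u \<lless> lf c"
    interpret m: strip_rep V "\<lambda>v. - rt v" "\<lambda>v. - lf v" by (rule mirror)
    show ?thesis using m.delta_nbh_if_left[OF u, of d ds] r d c empty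
      unfolding N_def NL_def NR_def strip_graph_mirror by auto
  qed
qed

end

section \<open>Placing the derivatives\<close>

lemma real_separation:
  fixes A B F :: "real set"
  assumes "finite A" "finite B" "finite F" "\<And>a b. \<lbrakk>a \<in> A; b \<in> B\<rbrakk> \<Longrightarrow> a < b"
  obtains t where "t \<notin> F" "\<And>a. a \<in> A \<Longrightarrow> a < t" "\<And>b. b \<in> B \<Longrightarrow> t < b"
proof -
  \<comment> \<open>An empty \<open>A\<close> or \<open>B\<close> imposes no bound on its side; an
    interval of length 1 beyond the other set, or ending at 0 if both are empty, is taken
    instead.\<close>
  obtain lo hi where lh: "lo < hi" "\<And>a. a \<in> A \<Longrightarrow> a \<le> lo" "\<And>b. b \<in> B \<Longrightarrow> hi \<le> b"
  proof (cases "A = {}")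
    case True
    show thesis
    proof (rule that)
      show "(if B = {} then 0 else Min B) - 1 < (if B = {} then 0 else Min B)" by simp
    qed (use True assms in auto)
  next
    case False
    show thesis
    proof (rule that)
      show "Max A < (if B = {} then Max A + 1 else Min B)"
        using assms(4)[OF Max_in[OF assms(1) False], of "Min B"] assms(2) by (cases "B = {}") auto
    qed (use assms in auto)
  qed
  have "infinite ({lo<..<hi} - F)" using lh(1) assms(3) by (simp add: infinite_Ioo)
  then obtain t where "t \<in> {lo<..<hi} - F" using infinite_imp_nonempty by blast
  then show thesis using lh that[of t] by force
qed

text \<open>A derivative and its shadow have to agree on the direction in which they cross a side of
  a vertex still to be split, since that side may become the shadow of a later derivative.\<close>

definition cuts_alike :: "line \<Rightarrow> line \<Rightarrow> line \<Rightarrow> bool" where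
  "cuts_alike l l' m \<longleftrightarrow> cuts l m \<and> cuts l' m \<or> cuts m l \<and> cuts m l'"

lemma cuts_alike_uminus [simp]: "cuts_alike (- l) (- l') (- m) \<longleftrightarrow> cuts_alike l l' m"
  by (auto simp: cuts_alike_def)

text \<open>\<open>B\<close> is the set of vertices that have not been split; every other vertex \<open>z\<close> is a derivative,
  drawn as a line, and its shadow \<open>S z\<close> is the side of the original trapezoid that it stands for.
  The conditions \<open>shadow_left\<close> and \<open>shadow_right\<close> anticipate the splitting of \<open>y\<close>: the derivative of
  \<open>y\<close> on a given side can only cross \<open>z\<close> if \<open>z\<close> meets some vertex on that side of \<open>y\<close>.\<close>

locale shadowed_rep = strip_rep V lf rt for V :: "'a set" and lf rt :: "'a \<Rightarrow> line" +
  fixes B :: "'a set" and S :: "'a \<Rightarrow> line"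
  assumes B_subset: "B \<subseteq> V"
    and derivative_is_line: "z \<in> V - B \<Longrightarrow> lf z = rt z"
    and shadow_left: "\<lbrakk>z \<in> V - B; y \<in> B; a \<in> V; meet lf rt z y; meet lf rt z a; rt a \<lless> lf y\<rbrakk>
      \<Longrightarrow> cuts_alike (lf z) (S z) (lf y)"
    and shadow_right: "\<lbrakk>z \<in> V - B; y \<in> B; a \<in> V; meet lf rt z y; meet lf rt z a; rt y \<lless> lf a\<rbrakk>
      \<Longrightarrow> cuts_alike (lf z) (S z) (rt y)"
    and shadow_cuts: "\<lbrakk>z \<in> V - B; z' \<in> V - B; cuts (lf z) (lf z')\<rbrakk> \<Longrightarrow> cuts (S z) (S z')"
begin

text \<open>Reflection exchanges \<open>shadow_left\<close> and \<open>shadow_right\<close> and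
  reverses all crossings, so \<open>shadow_cuts\<close> is used with its two lines
  interchanged.\<close>

lemma mirror_shadowed: "shadowed_rep V (\<lambda>v. - rt v) (\<lambda>v. - lf v) B (\<lambda>v. - S v)"
proof -
  interpret m: strip_rep V "\<lambda>v. - rt v" "\<lambda>v. - lf v" by (rule mirror)
  show ?thesis
  proof
    show "B \<subseteq> V" by (rule B_subset)
  next
    fix z assume "z \<in> V - B"
    then show "- rt z = - lf z" using derivative_is_line by simp
  next
    fix z y a
    assume "z \<in> V - B" "y \<in> B" "a \<in> V" "meet (\<lambda>v. - rt v) (\<lambda>v. - lf v) z y"
      "meet (\<lambda>v. - rt v) (\<lambda>v. - lf v) z a" "- lf a \<lless> - rt y"
    then show "cuts_alike (- rt z) (- S z) (- rt y)"
      using shadow_right[of z y a] derivative_is_line[of z] by simp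
  next
    fix z y a
    assume "z \<in> V - B" "y \<in> B" "a \<in> V" "meet (\<lambda>v. - rt v) (\<lambda>v. - lf v) z y"
      "meet (\<lambda>v. - rt v) (\<lambda>v. - lf v) z a" "- lf y \<lless> - rt a"
    then show "cuts_alike (- rt z) (- S z) (- lf y)"
      using shadow_left[of z y a] derivative_is_line[of z] by simp
  next
    fix z z' assume "z \<in> V - B" "z' \<in> V - B" "cuts (- rt z) (- rt z')"
    then show "cuts (- S z) (- S z')"
      using shadow_cuts[of z' z] derivative_is_line[of z] derivative_is_line[of z'] by simp
  qed
qed

text \<open>This serves to delete a split vertex once its derivatives are in place.\<close>

lemma restrict: "V' \<subseteq> V \<Longrightarrow> shadowed_rep V' lf rt (B \<inter> V') S"
proof
  assume sub: "V' \<subseteq> V"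
  show "finite V'" using sub finite_V finite_subset by blast
  show "\<And>v. v \<in> V' \<Longrightarrow> fst (lf v) \<le> fst (rt v) \<and> snd (lf v) \<le> snd (rt v)"
    using sub lf_le_rt by blast
  show "\<And>v w l m. \<lbrakk>v \<in> V'; w \<in> V'; v \<noteq> w; l \<in> {lf v, rt v}; m \<in> {lf w, rt w}\<rbrakk>
      \<Longrightarrow> fst l \<noteq> fst m \<and> snd l \<noteq> snd m"
    using sub endpoints_differ by blast
  show "B \<inter> V' \<subseteq> V'" by blast
  show "\<And>z. z \<in> V' - B \<inter> V' \<Longrightarrow> lf z = rt z" using sub derivative_is_line by blast
  show "\<And>z y a. \<lbrakk>z \<in> V' - B \<inter> V'; y \<in> B \<inter> V'; a \<in> V'; meet lf rt z y; meet lf rt z a; rt a \<lless> lf y\<rbrakk>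
      \<Longrightarrow> cuts_alike (lf z) (S z) (lf y)" using sub shadow_left by blast
  show "\<And>z y a. \<lbrakk>z \<in> V' - B \<inter> V'; y \<in> B \<inter> V'; a \<in> V'; meet lf rt z y; meet lf rt z a; rt y \<lless> lf a\<rbrakk>
      \<Longrightarrow> cuts_alike (lf z) (S z) (rt y)" using sub shadow_right by blast
  show "\<And>z z'. \<lbrakk>z \<in> V' - B \<inter> V'; z' \<in> V' - B \<inter> V'; cuts (lf z) (lf z')\<rbrakk> \<Longrightarrow> cuts (S z) (S z')"
    using sub shadow_cuts by blast
qed

section \<open>Inserting a new line\<close>

lemma strip_rep_insert:
  assumes z: "z \<notin> V"
    and fresh: "\<And>v. v \<in> V \<Longrightarrow> fst l \<notin> {fst (lf v), fst (rt v)} \<and> snd l \<notin> {snd (lf v), snd (rt v)}"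
  shows "strip_rep (insert z V) (lf(z := l)) (rt(z := l))"
proof
  show "finite (insert z V)" using finite_V by simp
  show "\<And>v. v \<in> insert z V \<Longrightarrow> fst ((lf(z := l)) v) \<le> fst ((rt(z := l)) v) \<and>
      snd ((lf(z := l)) v) \<le> snd ((rt(z := l)) v)"
    using lf_le_rt by auto
next
  fix v w l' m
  assume vw: "v \<in> insert z V" "w \<in> insert z V" "v \<noteq> w"
    and l': "l' \<in> {(lf(z := l)) v, (rt(z := l)) v}" and m: "m \<in> {(lf(z := l)) w, (rt(z := l)) w}"
  consider "v = z" "w \<in> V" | "w = z" "v \<in> V" | "v \<in> V" "w \<in> V" "v \<noteq> z" "w \<noteq> z"
    using vw by blast
  then show "fst l' \<noteq> fst m \<and> snd l' \<noteq> snd m"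
  proof cases
    case 1
    then have "l' = l" "m \<in> {lf w, rt w}" using l' m z by auto
    then show ?thesis using fresh[OF \<open>w \<in> V\<close>] by auto
  next
    case 2
    then have "m = l" "l' \<in> {lf v, rt v}" using l' m z by auto
    then show ?thesis using fresh[OF \<open>v \<in> V\<close>] by auto
  next
    case 3
    then show ?thesis using endpoints_differ[of v w l' m] vw l' m by simp
  qed
qed

text \<open>The new line runs between the vertices left of \<open>w\<close>, collected in
  \<open>A\<close>, and the set \<open>X\<close> of \<open>w\<close> and its neighbours that meet
  nothing in \<open>A\<close>. Its shadow is the left side of \<open>w\<close>. The vertex
  \<open>w\<close> stays, because another derivative may still have to be placed beside it.\<close>

lemma add_left:
  assumes w: "w \<in> B" and z: "z \<notin> V"
  obtains l where "shadowed_rep (insert z V) (lf(z := l)) (rt(z := l)) B (S(z := lf w))"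
    "l \<lless> lf w"
    "\<And>v. \<lbrakk>v \<in> V; v \<noteq> w\<rbrakk> \<Longrightarrow> \<not> rt v \<lless> l \<and> \<not> l \<lless> lf v \<longleftrightarrow>
       adj w v \<and> (\<exists>a\<in>V. rt a \<lless> lf w \<and> adj a v)"
proof -
  have wV: "w \<in> V" using w B_subset by blast
  define A where "A = {a \<in> V. rt a \<lless> lf w}"
  define X where "X = insert w {x \<in> V. x \<noteq> w \<and> adj w x \<and> \<not> (\<exists>a\<in>A. adj a x)}"
  \<comment> \<open>A neighbour \<open>x\<close> of \<open>w\<close> that misses \<open>a\<close>
    cannot be left of \<open>a\<close>, since it would then be left of \<open>w\<close>.\<close>
  have AX: "rt a \<lless> lf x" if "a \<in> A" "x \<in> X" for a x
  proof (cases "x = w")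
    case False
    then have "\<not> adj a x" "adj w x" using that by (auto simp: X_def)
    then show ?thesis
      using left_of_trans_via[of a x w] that(1) by (auto simp: A_def meet_def)
  qed (use that in \<open>simp add: A_def\<close>)
  have fin: "finite A" "finite X" using finite_V by (simp_all add: A_def X_def)
  \<comment> \<open>By \<open>AX\<close> the endpoints can be chosen independently, \<open>t\<close>
    on the upper and \<open>s\<close> on the lower line, each avoiding all endpoints in use.\<close>
  obtain t where t: "t \<notin> (\<lambda>v. fst (lf v)) ` V \<union> (\<lambda>v. fst (rt v)) ` V"
    "\<And>a. a \<in> (\<lambda>v. fst (rt v)) ` A \<Longrightarrow> a < t" "\<And>b. b \<in> (\<lambda>v. fst (lf v)) ` X \<Longrightarrow> t < b"
    by (rule real_separation[of "(\<lambda>v. fst (rt v)) ` A" "(\<lambda>v. fst (lf v)) ` X"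
          "(\<lambda>v. fst (lf v)) ` V \<union> (\<lambda>v. fst (rt v)) ` V"])
      (use fin finite_V AX in \<open>auto simp: left_of_def\<close>)
  obtain s where s: "s \<notin> (\<lambda>v. snd (lf v)) ` V \<union> (\<lambda>v. snd (rt v)) ` V"
    "\<And>a. a \<in> (\<lambda>v. snd (rt v)) ` A \<Longrightarrow> a < s" "\<And>b. b \<in> (\<lambda>v. snd (lf v)) ` X \<Longrightarrow> s < b"
    by (rule real_separation[of "(\<lambda>v. snd (rt v)) ` A" "(\<lambda>v. snd (lf v)) ` X"
          "(\<lambda>v. snd (lf v)) ` V \<union> (\<lambda>v. snd (rt v)) ` V"])
      (use fin finite_V AX in \<open>auto simp: left_of_def\<close>)
  define l where "l = (t, s)"
  have Al: "rt a \<lless> l" if "a \<in> A" for a using that t(2) s(2) by (auto simp: left_of_def l_def)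
  have Xl: "l \<lless> lf x" if "x \<in> X" for x using that t(3) s(3) by (auto simp: left_of_def l_def)
  have lw: "l \<lless> lf w" by (rule Xl) (simp add: X_def)
  have adj_l: "\<not> rt v \<lless> l \<and> \<not> l \<lless> lf v \<longleftrightarrow> adj w v \<and> (\<exists>a\<in>A. adj a v)"
    if v: "v \<in> V" "v \<noteq> w" for v
  proof -
    consider "v \<in> A" | "rt w \<lless> lf v" | "adj w v" using v by (auto simp: A_def meet_def)
    then show ?thesis
    proof cases
      case 1
      then show ?thesis using Al by (auto simp: A_def meet_def)
    next
      case 2
      then have "l \<lless> lf v" using lw lf_le_rt[OF wV] by (auto simp: left_of_def)
      then show ?thesis using 2 by (auto simp: meet_def)
    next
      case 3
      show ?thesis
      proof (cases "\<exists>a\<in>A. adj a v")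
        case True
        then obtain a where a: "a \<in> A" "adj a v" by blast
        have "\<not> rt v \<lless> l" using 3 lw left_of_trans[of "rt v" l "lf w"] by (auto simp: meet_def)
        moreover have "\<not> l \<lless> lf v" using a Al[of a] left_of_trans[of "rt a" l "lf v"] by (auto simp: meet_def)
        ultimately show ?thesis using True 3 by blast
      next
        case False
        then have "v \<in> X" using v 3 by (simp add: X_def)
        then show ?thesis using Xl False by blast
      qed
    qed
  qed
  let ?lf = "lf(z := l)" and ?rt = "rt(z := l)" and ?S = "S(z := lf w)"
  have old: "meet ?lf ?rt a b \<longleftrightarrow> adj a b" if "a \<in> V" "b \<in> V" for a b
    using that z by (auto simp: meet_def)
  have new: "v \<noteq> w \<and> adj w v \<and> (\<exists>a\<in>A. adj a v)" if "v \<in> V" "meet ?lf ?rt z v" for v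
  proof -
    have "v \<noteq> z" using that z by blast
    then have "\<not> rt v \<lless> l" "\<not> l \<lless> lf v" using that by (auto simp: meet_def)
    then show ?thesis using adj_l[of v] that lw by blast
  qed
  have wz: "w \<noteq> z" using wV z by blast
  have "strip_rep (insert z V) ?lf ?rt"
    by (rule strip_rep_insert[OF z]) (use t(1) s(1) in \<open>auto simp: l_def\<close>)
  then interpret s: strip_rep "insert z V" ?lf ?rt .
  have "shadowed_rep (insert z V) ?lf ?rt B ?S"
  proof
    show "B \<subseteq> insert z V" using B_subset by blast
    show "\<And>x. x \<in> insert z V - B \<Longrightarrow> ?lf x = ?rt x" using derivative_is_line by auto
  next
    fix x y a
    assume x: "x \<in> insert z V - B" and y: "y \<in> B" and a: "a \<in> insert z V"
      and xy: "meet ?lf ?rt x y" and xa: "meet ?lf ?rt x a" and ay: "?rt a \<lless> ?lf y"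
    have yV: "y \<in> V" "y \<noteq> z" using y B_subset z by auto
    show "cuts_alike (?lf x) (?S x) (?lf y)"
    proof (cases "x = z")
      case True
      have aV: "a \<in> V" "a \<noteq> z"
        using a True xy ay yV by (auto simp: meet_def)
      \<comment> \<open>Since \<open>y\<close> meets some \<open>b\<close> in \<open>A\<close>, its
        left side is left of \<open>l\<close> and of \<open>lf w\<close> at one end. Since
        \<open>a\<close> is left of \<open>y\<close> and meets \<open>w\<close>, the left side of
        \<open>y\<close> is right of both at the other end. So \<open>l\<close> and its shadow cross
        it alike.\<close>
      obtain b where b: "b \<in> A" "adj b y" and yw: "y \<noteq> w" "adj w y"
        using new[of y] xy yV True by blast
      have aw: "a \<noteq> w" "adj w a" using new[of a] xa aV True by blast+
      have bV: "b \<in> V" "rt b \<lless> lf w" using b by (auto simp: A_def)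
      have "b \<noteq> y" using yw bV by (auto simp: meet_def)
      then have 1: "fst (lf y) < fst (rt b) \<or> snd (lf y) < snd (rt b)"
        using not_left_ofD[of b y] b bV yV by (auto simp: meet_def)
      have 2: "fst (lf w) < fst (rt a) \<or> snd (lf w) < snd (rt a)"
        using not_left_ofD[of a w] aw aV wV by (auto simp: meet_def)
      have 3: "rt a \<lless> lf y" using ay aV yV by simp
      show ?thesis
        using 1 2 3 Al[OF b(1)] lw True yV by (auto simp: cuts_alike_def cuts_def left_of_def)
    next
      case False
      then have xV: "x \<in> V - B" using x by blast
      have "adj x y" using xy old xV yV by blast
      show ?thesis
      proof (cases "a = z")
        case True
        \<comment> \<open>As \<open>x\<close> meets the new line, it meets some \<open>b\<close> in
          \<open>A\<close>, which is left of the new line and hence of \<open>y\<close>: an old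
          witness replaces \<open>z\<close>.\<close>
        then obtain b where b: "b \<in> A" "adj b x" using new[of x] xV xa by (auto simp: meet_commute)
        have "rt b \<lless> lf y" using left_of_trans[OF Al[OF b(1)]] ay True yV by simp
        then show ?thesis
          using shadow_left[OF xV y _ \<open>adj x y\<close>, of b] b False yV by (auto simp: A_def meet_commute)
      next
        case False
        then have "a \<in> V" using a by blast
        then show ?thesis
          using shadow_left[OF xV y _ \<open>adj x y\<close>, of a] \<open>x \<noteq> z\<close> yV False xa ay old xV by auto
      qed
    qed
  next
    fix x y a
    assume x: "x \<in> insert z V - B" and y: "y \<in> B" and a: "a \<in> insert z V"
      and xy: "meet ?lf ?rt x y" and xa: "meet ?lf ?rt x a" and ya: "?rt y \<lless> ?lf a"
    have yV: "y \<in> V" "y \<noteq> z" using y B_subset z by auto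
    show "cuts_alike (?lf x) (?S x) (?rt y)"
    proof (cases "x = z")
      case True
      have aV: "a \<in> V" "a \<noteq> z"
        using a True xy ya yV by (auto simp: meet_def)
      \<comment> \<open>The same comparison for the right side of \<open>y\<close>: it is left of
        \<open>l\<close> and \<open>lf w\<close> at the end where \<open>a\<close> reaches back to
        \<open>b\<close>, and right of both at the other end because \<open>y\<close> meets
        \<open>w\<close>.\<close>
      obtain b where b: "b \<in> A" "adj b a" and aw: "a \<noteq> w" "adj w a"
        using new[of a] xa aV True by blast
      have yw: "y \<noteq> w" "adj w y" using new[of y] xy yV True by blast+
      have bV: "b \<in> V" "rt b \<lless> lf w" using b by (auto simp: A_def)
      have "b \<noteq> a" using aw bV by (auto simp: meet_def)
      then have 1: "fst (lf a) < fst (rt b) \<or> snd (lf a) < snd (rt b)"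
        using not_left_ofD[of b a] b bV aV by (auto simp: meet_def)
      have 2: "fst (lf w) < fst (rt y) \<or> snd (lf w) < snd (rt y)"
        using not_left_ofD[of y w] yw yV wV by (auto simp: meet_def)
      have 3: "rt y \<lless> lf a" using ya aV yV by simp
      show ?thesis
        using 1 2 3 Al[OF b(1)] lw True yV by (auto simp: cuts_alike_def cuts_def left_of_def)
    next
      case False
      then have xV: "x \<in> V - B" using x by blast
      have "adj x y" using xy old xV yV by blast
      show ?thesis
      proof (cases "a = z")
        case True
        \<comment> \<open>Here \<open>w\<close> is the old witness: it lies right of
          \<open>l\<close>, hence of \<open>y\<close>, and meets \<open>x\<close>.\<close>
        then have "adj w x" using new[of x] xV xa by (auto simp: meet_commute)
        moreover have "rt y \<lless> lf w" using left_of_trans[OF _ lw] ya True yV by simp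
        ultimately show ?thesis
          using shadow_right[OF xV y wV \<open>adj x y\<close>] False yV by (auto simp: meet_commute)
      next
        case False
        then have "a \<in> V" using a by blast
        then show ?thesis
          using shadow_right[OF xV y _ \<open>adj x y\<close>, of a] \<open>x \<noteq> z\<close> yV False xa ya old xV by auto
      qed
    qed
  next
    fix x x'
    assume x: "x \<in> insert z V - B" "x' \<in> insert z V - B" and c: "cuts (?lf x) (?lf x')"
    \<comment> \<open>An old derivative that crosses \<open>l\<close> meets \<open>w\<close> and
      some vertex of \<open>A\<close>, so \<open>shadow_left\<close> applies to the left side of
      \<open>w\<close>. As \<open>l\<close> is left of \<open>lf w\<close>, both are crossed in the
      same direction.\<close>
    have alike: "cuts_alike (lf y) (S y) (lf w)"
      if y: "y \<in> V - B" and cut: "cuts l (lf y) \<or> cuts (lf y) l" for y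
    proof -
      have "meet ?lf ?rt z y"
        using cut derivative_is_line[OF y] y z by (auto simp: meet_def cuts_def left_of_def)
      then obtain b where "b \<in> A" "adj b y" "adj w y" using new[of y] y by blast
      then show ?thesis
        using shadow_left[OF y w, of b] by (auto simp: A_def meet_commute)
    qed
    consider "x \<in> V - B" "x' \<in> V - B" "x \<noteq> z" "x' \<noteq> z" | "x = z" "x' = z"
      | "x = z" "x' \<in> V - B" "x' \<noteq> z" | "x' = z" "x \<in> V - B" "x \<noteq> z"
      using x z by blast
    then show "cuts (?S x) (?S x')"
    proof cases
      case 1
      then show ?thesis using shadow_cuts c by simp
    next
      case 2
      then show ?thesis using c by (simp add: cuts_def)
    next
      case 3
      then show ?thesis using alike[of x'] c lw
        by (auto simp: cuts_alike_def cuts_def left_of_def)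
    next
      case 4
      then show ?thesis using alike[of x] c lw
        by (auto simp: cuts_alike_def cuts_def left_of_def)
    qed
  qed
  then show thesis
  proof (rule that)
    show "l \<lless> lf w" by (rule lw)
    show "\<And>v. \<lbrakk>v \<in> V; v \<noteq> w\<rbrakk> \<Longrightarrow> \<not> rt v \<lless> l \<and> \<not> l \<lless> lf v \<longleftrightarrow>
       adj w v \<and> (\<exists>a\<in>V. rt a \<lless> lf w \<and> adj a v)"
      using adj_l by (auto simp: A_def)
  qed
qed

text \<open>The mirror image of \<open>add_left\<close>; the line found in the reflected
  representation is negated back.\<close>

lemma add_right:
  assumes w: "w \<in> B" and z: "z \<notin> V"
  obtains l where "shadowed_rep (insert z V) (lf(z := l)) (rt(z := l)) B (S(z := rt w))"
    "rt w \<lless> l"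
    "\<And>v. \<lbrakk>v \<in> V; v \<noteq> w\<rbrakk> \<Longrightarrow> \<not> rt v \<lless> l \<and> \<not> l \<lless> lf v \<longleftrightarrow>
       adj w v \<and> (\<exists>a\<in>V. rt w \<lless> lf a \<and> adj a v)"
proof -
  interpret m: shadowed_rep V "\<lambda>v. - rt v" "\<lambda>v. - lf v" B "\<lambda>v. - S v" by (rule mirror_shadowed)
  obtain l where l: "shadowed_rep (insert z V) ((\<lambda>v. - rt v)(z := l)) ((\<lambda>v. - lf v)(z := l)) B
      ((\<lambda>v. - S v)(z := - rt w))" "l \<lless> - rt w"
    "\<And>v. \<lbrakk>v \<in> V; v \<noteq> w\<rbrakk> \<Longrightarrow> \<not> - lf v \<lless> l \<and> \<not> l \<lless> - rt v \<longleftrightarrow>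
       adj w v \<and> (\<exists>a\<in>V. rt w \<lless> lf a \<and> adj a v)"
    by (rule m.add_left[OF w z, unfolded meet_mirror uminus_left_of_uminus]) blast
  have flip: "(\<lambda>v. - ((\<lambda>v. - f v)(z := m)) v) = f(z := - m)" for f :: "'a \<Rightarrow> line" and m
    by auto
  have neg: "l \<lless> - m \<longleftrightarrow> m \<lless> - l" "- m \<lless> l \<longleftrightarrow> - l \<lless> m" for m
    by (auto simp: left_of_def)
  show thesis
  proof (rule that)
    show "shadowed_rep (insert z V) (lf(z := - l)) (rt(z := - l)) B (S(z := rt w))"
      using shadowed_rep.mirror_shadowed[OF l(1)] unfolding flip by simp
    show "rt w \<lless> - l" using l(2) neg by blast
    show "\<And>v. \<lbrakk>v \<in> V; v \<noteq> w\<rbrakk> \<Longrightarrow> \<not> rt v \<lless> - l \<and> \<not> - l \<lless> lf v \<longleftrightarrow>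
       adj w v \<and> (\<exists>a\<in>V. rt w \<lless> lf a \<and> adj a v)"
      using l(3) neg by blast
  qed
qed

text \<open>A derivative without neighbours is drawn to the right of everything. It crosses nothing,
  so its shadow is arbitrary.\<close>

lemma add_isolated:
  assumes z: "z \<notin> V"
  obtains l where "shadowed_rep (insert z V) (lf(z := l)) (rt(z := l)) B (S(z := s))"
    "\<And>v. v \<in> V \<Longrightarrow> rt v \<lless> l"
proof -
  obtain t where t: "\<And>a. a \<in> (\<lambda>v. fst (rt v)) ` V \<Longrightarrow> a < t"
    by (rule real_separation[of "(\<lambda>v. fst (rt v)) ` V" "{}" "{}"]) (use finite_V in auto)
  obtain b where b: "\<And>a. a \<in> (\<lambda>v. snd (rt v)) ` V \<Longrightarrow> a < b"
    by (rule real_separation[of "(\<lambda>v. snd (rt v)) ` V" "{}" "{}"]) (use finite_V in auto)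
  define l where "l = (t, b)"
  have l: "rt v \<lless> l" if "v \<in> V" for v using that t b by (auto simp: l_def left_of_def)
  let ?lf = "lf(z := l)" and ?rt = "rt(z := l)" and ?S = "S(z := s)"
  have old: "meet ?lf ?rt a b \<longleftrightarrow> adj a b" if "a \<in> V" "b \<in> V" for a b
    using that z by (auto simp: meet_def)
  have isol: "\<not> meet ?lf ?rt z v" "\<not> meet ?lf ?rt v z" if "v \<in> V" for v
    using l[OF that] that z by (auto simp: meet_def)
  have "strip_rep (insert z V) ?lf ?rt"
  proof (rule strip_rep_insert[OF z])
    fix v assume "v \<in> V"
    then show "fst l \<notin> {fst (lf v), fst (rt v)} \<and> snd l \<notin> {snd (lf v), snd (rt v)}"
      using l[of v] lf_le_rt[of v] by (auto simp: left_of_def)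
  qed
  then interpret s: strip_rep "insert z V" ?lf ?rt .
  have "shadowed_rep (insert z V) ?lf ?rt B ?S"
  proof
    show "B \<subseteq> insert z V" using B_subset by blast
    show "\<And>x. x \<in> insert z V - B \<Longrightarrow> ?lf x = ?rt x" using derivative_is_line by auto
  next
    fix x y a
    assume x: "x \<in> insert z V - B" and y: "y \<in> B" and a: "a \<in> insert z V"
      and xy: "meet ?lf ?rt x y" and xa: "meet ?lf ?rt x a" and ay: "?rt a \<lless> ?lf y"
    have yV: "y \<in> V" "y \<noteq> z" using y B_subset z by auto
    have xV: "x \<in> V - B" "x \<noteq> z" using x xy isol yV by auto
    have aV: "a \<in> V" "a \<noteq> z" using a xa isol xV by auto
    show "cuts_alike (?lf x) (?S x) (?lf y)"
      using shadow_left[of x y a] xV y yV aV old xy xa ay by auto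
  next
    fix x y a
    assume x: "x \<in> insert z V - B" and y: "y \<in> B" and a: "a \<in> insert z V"
      and xy: "meet ?lf ?rt x y" and xa: "meet ?lf ?rt x a" and ya: "?rt y \<lless> ?lf a"
    have yV: "y \<in> V" "y \<noteq> z" using y B_subset z by auto
    have xV: "x \<in> V - B" "x \<noteq> z" using x xy isol yV by auto
    have aV: "a \<in> V" "a \<noteq> z" using a xa isol xV by auto
    show "cuts_alike (?lf x) (?S x) (?rt y)"
      using shadow_right[of x y a] xV y yV aV old xy xa ya by auto
  next
    fix x x'
    assume x: "x \<in> insert z V - B" "x' \<in> insert z V - B" and c: "cuts (?lf x) (?lf x')"
    have "\<not> cuts l (lf v) \<and> \<not> cuts (lf v) l" if "v \<in> V" for v
      using l[OF that] lf_le_rt[OF that] by (auto simp: cuts_def left_of_def)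
    moreover have "\<not> cuts l l" by (simp add: cuts_def)
    ultimately have "x \<noteq> z" "x' \<noteq> z" using x c by (auto split: if_splits)
    then have "x \<in> V - B" "x' \<in> V - B" using x by auto
    then show "cuts (?S x) (?S x')" using shadow_cuts c \<open>x \<noteq> z\<close> \<open>x' \<noteq> z\<close> by simp
  qed
  then show thesis using that l by blast
qed

end

section \<open>Replacing a vertex by its two derivatives\<close>

definition left_reach :: "'a set \<Rightarrow> ('a \<Rightarrow> line) \<Rightarrow> ('a \<Rightarrow> line) \<Rightarrow> 'a \<Rightarrow> 'a set" where
  "left_reach V lf rt w =
     {x \<in> V. x \<noteq> w \<and> meet lf rt w x \<and> (\<exists>a\<in>V. rt a \<lless> lf w \<and> meet lf rt a x)}"

definition right_reach :: "'a set \<Rightarrow> ('a \<Rightarrow> line) \<Rightarrow> ('a \<Rightarrow> line) \<Rightarrow> 'a \<Rightarrow> 'a set" where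
  "right_reach V lf rt w =
     {x \<in> V. x \<noteq> w \<and> meet lf rt w x \<and> (\<exists>a\<in>V. rt w \<lless> lf a \<and> meet lf rt a x)}"

context shadowed_rep
begin

text \<open>By \<open>delta_nbh\<close> the neighbourhood of a derivative is one of these three
  sets. The last conclusion locates the new line beside \<open>w\<close>; it ensures that this line
  does not alter the reach of \<open>w\<close> before the other derivative is placed.\<close>

lemma add_derivative:
  assumes w: "w \<in> B" and z: "z \<notin> V"
    and N: "N \<in> {{}, left_reach V lf rt w, right_reach V lf rt w}"
  obtains l s where "s \<in> {lf w, rt w}"
    "shadowed_rep (insert z V) (lf(z := l)) (rt(z := l)) B (S(z := s))"
    "\<And>v. v \<in> V \<Longrightarrow> \<not> rt v \<lless> l \<and> \<not> l \<lless> lf v \<longleftrightarrow> v \<in> N"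
    "l \<lless> lf w \<and> N \<subseteq> left_reach V lf rt w \<or> rt w \<lless> l \<and> N \<subseteq> right_reach V lf rt w"
proof -
  have wV: "w \<in> V" using w B_subset by blast
  consider "N = {}" | "N = left_reach V lf rt w" | "N = right_reach V lf rt w" using N by blast
  then show thesis
  proof cases
    case 1
    obtain l where l: "shadowed_rep (insert z V) (lf(z := l)) (rt(z := l)) B (S(z := lf w))"
      "\<And>v. v \<in> V \<Longrightarrow> rt v \<lless> l"
      by (rule add_isolated[OF z]) blast
    show thesis
      by (rule that[OF _ l(1)]) (use 1 l(2) wV in auto)
  next
    case 2
    obtain l where l: "shadowed_rep (insert z V) (lf(z := l)) (rt(z := l)) B (S(z := lf w))"
      "l \<lless> lf w"
      "\<And>v. \<lbrakk>v \<in> V; v \<noteq> w\<rbrakk> \<Longrightarrow> \<not> rt v \<lless> l \<and> \<not> l \<lless> lf v \<longleftrightarrow>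
         adj w v \<and> (\<exists>a\<in>V. rt a \<lless> lf w \<and> adj a v)"
      by (rule add_left[OF w z]) blast
    have "\<not> rt v \<lless> l \<and> \<not> l \<lless> lf v \<longleftrightarrow> v \<in> N" if "v \<in> V" for v
      using l(2) l(3)[of v] that by (cases "v = w") (auto simp: 2 left_reach_def)
    then show thesis using that[OF _ l(1)] l(2) 2 by blast
  next
    case 3
    obtain l where l: "shadowed_rep (insert z V) (lf(z := l)) (rt(z := l)) B (S(z := rt w))"
      "rt w \<lless> l"
      "\<And>v. \<lbrakk>v \<in> V; v \<noteq> w\<rbrakk> \<Longrightarrow> \<not> rt v \<lless> l \<and> \<not> l \<lless> lf v \<longleftrightarrow>
         adj w v \<and> (\<exists>a\<in>V. rt w \<lless> lf a \<and> adj a v)"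
      by (rule add_right[OF w z]) blast
    have "\<not> rt v \<lless> l \<and> \<not> l \<lless> lf v \<longleftrightarrow> v \<in> N" if "v \<in> V" for v
      using l(2) l(3)[of v] that by (cases "v = w") (auto simp: 3 right_reach_def)
    then show thesis using that[OF _ l(1)] l(2) 3 by blast
  qed
qed

text \<open>The two lines are inserted one after the other while \<open>w\<close> is still present,
  and \<open>w\<close> is removed at the end by \<open>restrict\<close>.\<close>

lemma vertex_splitting_step:
  assumes w: "w \<in> B" and split: "vertex_splitting G w x1 x2 H"
  obtains l1 l2 s1 s2 where "s1 \<in> {lf w, rt w}" "s2 \<in> {lf w, rt w}"
    "shadowed_rep (V - {w} \<union> {x1, x2}) (lf(x1 := l1, x2 := l2)) (rt(x1 := l1, x2 := l2))
       (B - {w}) (S(x1 := s1, x2 := s2))"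
    "H = strip_graph (V - {w} \<union> {x1, x2}) (lf(x1 := l1, x2 := l2)) (rt(x1 := l1, x2 := l2))"
proof -
  have wV: "w \<in> V" using w B_subset by blast
  have x: "x1 \<notin> V" "x2 \<notin> V" "x1 \<noteq> x2" using split by (auto simp: vertex_splitting_def)
  obtain d ds where d: "delta_choice G w d ds"
    and H: "H = \<lparr> verts = V - {w} \<union> {x1, x2},
              edges = {e \<in> edges G. w \<notin> e}
                \<union> {{x1, x} | x. x \<in> N_1 G w d ds \<union> N_12 G w d ds}
                \<union> {{x2, x} | x. x \<in> N_2 G w d ds \<union> N_12 G w d ds} \<rparr>"
    using split by (auto simp: vertex_splitting_def)
  define N1 where "N1 = {x \<in> nbh G w. adj_to_set G x d}"
  define N2 where "N2 = {x \<in> nbh G w. adj_to_set G x ds}"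
  have N12: "N_1 G w d ds \<union> N_12 G w d ds = N1" "N_2 G w d ds \<union> N_12 G w d ds = N2"
    by (auto simp: N_1_def N_2_def N_12_def N1_def N2_def)
  have "left_reach V lf rt w = {x \<in> nbh G w. \<exists>a\<in>V. rt a \<lless> lf w \<and> adj a x}"
    "right_reach V lf rt w = {x \<in> nbh G w. \<exists>a\<in>V. rt w \<lless> lf a \<and> adj a x}"
    using wV by (auto simp: left_reach_def right_reach_def nbh_def)
  then have N: "N1 \<in> {{}, left_reach V lf rt w, right_reach V lf rt w}"
    "N2 \<in> {{}, left_reach V lf rt w, right_reach V lf rt w}"
    using delta_nbh[OF wV d] unfolding N1_def N2_def by auto
  have Nsub: "N1 \<subseteq> V - {w}" "N2 \<subseteq> V - {w}" by (auto simp: N1_def N2_def nbh_def)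
  obtain l1 s1 where s1: "s1 \<in> {lf w, rt w}"
    and rep1: "shadowed_rep (insert x1 V) (lf(x1 := l1)) (rt(x1 := l1)) B (S(x1 := s1))"
    and adj1: "\<And>v. v \<in> V \<Longrightarrow> \<not> rt v \<lless> l1 \<and> \<not> l1 \<lless> lf v \<longleftrightarrow> v \<in> N1"
    and side: "l1 \<lless> lf w \<and> N1 \<subseteq> left_reach V lf rt w \<or> rt w \<lless> l1 \<and> N1 \<subseteq> right_reach V lf rt w"
    by (rule add_derivative[OF w x(1) N(1)]) blast
  let ?V = "insert x1 V" and ?lf = "lf(x1 := l1)" and ?rt = "rt(x1 := l1)"
  interpret r1: shadowed_rep ?V ?lf ?rt B "S(x1 := s1)" by (rule rep1)
  have ne: "v \<noteq> x1" "v \<noteq> x2" if "v \<in> V" for v using that x by auto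
  have wx: "w \<noteq> x1" "w \<noteq> x2" using ne wV by blast+
  have meet_old: "meet ?lf ?rt a b \<longleftrightarrow> adj a b" if "a \<in> V" "b \<in> V" for a b
    using ne[OF that(1)] ne[OF that(2)] by (simp add: meet_def)
  have meet1: "meet ?lf ?rt x1 v \<longleftrightarrow> v \<in> N1" if "v \<in> V" for v
    using ne[OF that] adj1[OF that] by (auto simp: meet_def)
  have "w \<notin> N1" using Nsub by blast
  \<comment> \<open>The first derivative does not meet \<open>w\<close>, so it is not in the reach
    of \<open>w\<close>. As a witness on its side it accounts only for vertices of
    \<open>N1\<close>, which by \<open>side\<close> are in that reach already.\<close>
  have left_eq: "left_reach ?V ?lf ?rt w = left_reach V lf rt w"
  proof
    show "left_reach V lf rt w \<subseteq> left_reach ?V ?lf ?rt w"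
      using ne wV meet_old by (fastforce simp: left_reach_def)
    show "left_reach ?V ?lf ?rt w \<subseteq> left_reach V lf rt w"
    proof
      fix y assume y: "y \<in> left_reach ?V ?lf ?rt w"
      then obtain a where a: "a \<in> ?V" "?rt a \<lless> ?lf w" "meet ?lf ?rt a y"
        and yw: "y \<in> ?V" "y \<noteq> w" "meet ?lf ?rt w y"
        unfolding left_reach_def by blast
      have yV: "y \<in> V" using yw meet1[OF wV] \<open>w \<notin> N1\<close> by (auto simp: meet_commute)
      show "y \<in> left_reach V lf rt w"
      proof (cases "a = x1")
        case True
        then have "l1 \<lless> lf w" using a wx by simp
        then have "\<not> rt w \<lless> l1" using lf_le_rt[OF wV] by (auto simp: left_of_def)
        then show ?thesis using side meet1[OF yV] a True by blast
      next
        case False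
        then have "a \<in> V" using a by blast
        then show ?thesis using a yw yV meet_old wV wx False by (auto simp: left_reach_def)
      qed
    qed
  qed
  have right_eq: "right_reach ?V ?lf ?rt w = right_reach V lf rt w"
  proof
    show "right_reach V lf rt w \<subseteq> right_reach ?V ?lf ?rt w"
      using ne wV meet_old by (fastforce simp: right_reach_def)
    show "right_reach ?V ?lf ?rt w \<subseteq> right_reach V lf rt w"
    proof
      fix y assume y: "y \<in> right_reach ?V ?lf ?rt w"
      then obtain a where a: "a \<in> ?V" "?rt w \<lless> ?lf a" "meet ?lf ?rt a y"
        and yw: "y \<in> ?V" "y \<noteq> w" "meet ?lf ?rt w y"
        unfolding right_reach_def by blast
      have yV: "y \<in> V" using yw meet1[OF wV] \<open>w \<notin> N1\<close> by (auto simp: meet_commute)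
      show "y \<in> right_reach V lf rt w"
      proof (cases "a = x1")
        case True
        then have "rt w \<lless> l1" using a wx by simp
        then have "\<not> l1 \<lless> lf w" using lf_le_rt[OF wV] by (auto simp: left_of_def)
        then show ?thesis using side meet1[OF yV] a True by blast
      next
        case False
        then have "a \<in> V" using a by blast
        then show ?thesis using a yw yV meet_old wV wx False by (auto simp: right_reach_def)
      qed
    qed
  qed
  have x2: "x2 \<notin> ?V" using x by auto
  have N2': "N2 \<in> {{}, left_reach ?V ?lf ?rt w, right_reach ?V ?lf ?rt w}"
    unfolding left_eq right_eq by (rule N(2))
  obtain l2 s2 where s2: "s2 \<in> {?lf w, ?rt w}"
    and rep2: "shadowed_rep (insert x2 ?V) (?lf(x2 := l2)) (?rt(x2 := l2)) B (S(x1 := s1, x2 := s2))"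
    and adj2: "\<And>v. v \<in> ?V \<Longrightarrow> \<not> ?rt v \<lless> l2 \<and> \<not> l2 \<lless> ?lf v \<longleftrightarrow> v \<in> N2"
    by (rule r1.add_derivative[OF w x2 N2']) blast
  let ?V' = "V - {w} \<union> {x1, x2}" and ?lf' = "lf(x1 := l1, x2 := l2)"
    and ?rt' = "rt(x1 := l1, x2 := l2)"
  have old: "meet ?lf' ?rt' a b \<longleftrightarrow> adj a b" if "a \<in> V" "b \<in> V" for a b
    using ne[OF that(1)] ne[OF that(2)] by (simp add: meet_def)
  have m1: "meet ?lf' ?rt' x1 v \<longleftrightarrow> v \<in> N1" if "v \<in> V" for v
    using ne[OF that] adj1[OF that] x by (auto simp: meet_def)
  have m2: "meet ?lf' ?rt' x2 v \<longleftrightarrow> v \<in> N2" if "v \<in> V" for v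
    using ne[OF that] adj2[of v] that x by (auto simp: meet_def)
  \<comment> \<open>\<open>x1\<close> is not in \<open>N2\<close>, so the second line was placed
    without crossing the first.\<close>
  have m12: "\<not> meet ?lf' ?rt' x1 x2"
    using adj2[of x1] Nsub x by (auto simp: meet_def)
  have edges: "edges H = edges (strip_graph ?V' ?lf' ?rt')"
  proof
    show "edges H \<subseteq> edges (strip_graph ?V' ?lf' ?rt')"
    proof
      fix e assume "e \<in> edges H"
      then consider "e \<in> edges G" "w \<notin> e" | v where "e = {x1, v}" "v \<in> N1"
        | v where "e = {x2, v}" "v \<in> N2"
        unfolding H N12 by auto
      then show "e \<in> edges (strip_graph ?V' ?lf' ?rt')"
      proof cases
        case 1
        then obtain a b where "e = {a, b}" "a \<in> V" "b \<in> V" "a \<noteq> b" "adj a b"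
          by (elim edges_strip_graphE)
        then show ?thesis using 1 old by auto
      next
        case 2
        then have "v \<in> V - {w}" "v \<noteq> x1" using Nsub ne by auto
        then show ?thesis using 2 m1 by simp
      next
        case 3
        then have "v \<in> V - {w}" "v \<noteq> x2" using Nsub ne by auto
        then show ?thesis using 3 m2 by simp
      qed
    qed
    show "edges (strip_graph ?V' ?lf' ?rt') \<subseteq> edges H"
    proof
      fix e assume "e \<in> edges (strip_graph ?V' ?lf' ?rt')"
      then obtain a b where e: "e = {a, b}" "a \<in> ?V'" "b \<in> ?V'" "a \<noteq> b" "meet ?lf' ?rt' a b"
        by (rule edges_strip_graphE)
      have to_x1: "v \<in> N1" if "v \<in> ?V'" "v \<noteq> x1" "meet ?lf' ?rt' x1 v" for v
        using that m1[of v] m12 by blast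
      have to_x2: "v \<in> N2" if "v \<in> ?V'" "v \<noteq> x2" "meet ?lf' ?rt' x2 v" for v
        using that m2[of v] m12 meet_commute[of ?lf' ?rt' x1 x2] by blast
      consider "a = x1" | "b = x1" | "a = x2" | "b = x2" | "a \<in> V - {w}" "b \<in> V - {w}"
        using e by blast
      then show "e \<in> edges H"
      proof cases
        case 1
        then show ?thesis using to_x1[of b] e unfolding H N12 by auto
      next
        case 2
        then have "a \<in> N1" using to_x1[of a] e meet_commute by metis
        then show ?thesis using e 2 unfolding H N12 by auto
      next
        case 3
        then show ?thesis using to_x2[of b] e unfolding H N12 by auto
      next
        case 4
        then have "a \<in> N2" using to_x2[of a] e meet_commute by metis
        then show ?thesis using e 4 unfolding H N12 by auto
      next
        case 5
        then have "{a, b} \<in> edges G" using e old[of a b] by simp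
        then show ?thesis using e 5 unfolding H by auto
      qed
    qed
  qed
  have H_eq: "H = strip_graph ?V' ?lf' ?rt'"
  proof (rule graph.equality)
    show "verts H = verts (strip_graph ?V' ?lf' ?rt')" by (simp add: H)
  qed (simp_all add: edges)
  have B': "B \<inter> ?V' = B - {w}" using B_subset x by auto
  have "shadowed_rep ?V' ?lf' ?rt' (B \<inter> ?V') (S(x1 := s1, x2 := s2))"
    by (rule shadowed_rep.restrict[OF rep2]) auto
  then show thesis
    using that[OF s1 _ _ H_eq] s2 wx unfolding B' by simp
qed

end

section \<open>Iterated splitting\<close>

lemma intersection_graph_eq_strip_graph:
  assumes "\<And>x y. \<lbrakk>x \<in> V; y \<in> V\<rbrakk> \<Longrightarrow> F x \<inter> F y \<noteq> {} \<longleftrightarrow> meet lf rt x y"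
  shows "intersection_graph V F = strip_graph V lf rt"
proof -
  have "{{x, y} | x y. x \<in> V \<and> y \<in> V \<and> x \<noteq> y \<and> F x \<inter> F y \<noteq> {}} =
      {{x, y} | x y. x \<in> V \<and> y \<in> V \<and> x \<noteq> y \<and> meet lf rt x y}"
    by (intro Collect_cong ex_cong1 conj_cong refl) (rule assms)
  then show ?thesis by (simp add: intersection_graph_def strip_graph_def)
qed

lemma line_graph_eq_strip_graph:
  assumes "\<And>z. z \<in> D \<Longrightarrow> lf z = rt z"
  shows "line_graph D lf = strip_graph D lf rt"
proof -
  have "seg (lf x) \<inter> seg (lf y) \<noteq> {} \<longleftrightarrow> meet lf rt x y" if "x \<in> D" "y \<in> D" for x y
    using strips_meet_iff[of "lf x" "lf x" "lf y" "lf y"] assms that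
    by (simp add: seg_eq_strip meet_def)
  then show ?thesis
    unfolding line_graph_def by (rule intersection_graph_eq_strip_graph)
qed

text \<open>With distinct endpoints, two lines neither of which is left of the other cross properly;
  the angles then decide the direction.\<close>

lemma cuts_if_meet_theta_less:
  assumes "\<not> l \<lless> m" "\<not> m \<lless> l" "fst l \<noteq> fst m" "snd l \<noteq> snd m" "theta l < theta m"
  shows "cuts l m"
  using assms by (auto simp: theta_less_iff left_of_def cuts_def)

lemma cuts_imp_arc:
  assumes "cuts (T p) (T q)" "p \<in> D" "q \<in> D"
  shows "(p, q) \<in> Phi (line_graph D T) T"
proof -
  have "{p, q} \<in> edges (line_graph D T)"
    using assms line_graph_eq_strip_graph[of D T T] by (auto simp: meet_def cuts_def left_of_def)
  moreover have "theta (T p) < theta (T q)"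
    using assms by (simp add: theta_less_iff cuts_def)
  ultimately show ?thesis by (simp add: Phi_def)
qed

text \<open>Before any splitting there is no derivative, so the shadow conditions hold vacuously for
  every \<open>S\<close>.\<close>

lemma trapezoid_rep_imp_shadowed_rep:
  assumes "trapezoid_rep G T" "finite (verts G)"
  defines "lf \<equiv> \<lambda>v. T (v, Left_Side)" and "rt \<equiv> \<lambda>v. T (v, Right_Side)"
  shows "shadowed_rep (verts G) lf rt (verts G) S" and "G = strip_graph (verts G) lf rt"
proof -
  have inj: "inj_on (\<lambda>x. top_pt (T x)) (verts G \<times> UNIV)" "inj_on (\<lambda>x. bot_pt (T x)) (verts G \<times> UNIV)"
    and le: "\<And>v. v \<in> verts G \<Longrightarrow> fst (lf v) < fst (rt v) \<and> snd (lf v) < snd (rt v)"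
    and G: "G = intersection_graph (verts G) (trapezoid T)"
    using assms(1) by (auto simp: trapezoid_rep_def distinct_endpoints_def lf_def rt_def)
  have diff: "fst (T p) \<noteq> fst (T q) \<and> snd (T p) \<noteq> snd (T q)"
    if "fst p \<in> verts G" "fst q \<in> verts G" "p \<noteq> q" for p q
  proof -
    have "p \<in> verts G \<times> UNIV" "q \<in> verts G \<times> UNIV" using that by (simp_all add: mem_Times_iff)
    then show ?thesis
      using inj_onD[OF inj(1), of p q] inj_onD[OF inj(2), of p q] that(3)
      by (auto simp: top_pt_def bot_pt_def)
  qed
  show "shadowed_rep (verts G) lf rt (verts G) S"
  proof
    fix v w l m
    assume "v \<in> verts G" "w \<in> verts G" "v \<noteq> w" "l \<in> {lf v, rt v}" "m \<in> {lf w, rt w}"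
    then show "fst l \<noteq> fst m \<and> snd l \<noteq> snd m"
      unfolding lf_def rt_def using diff by auto
  qed (use assms(2) le in \<open>auto intro: less_imp_le\<close>)
  have "trapezoid T v \<inter> trapezoid T w \<noteq> {} \<longleftrightarrow> meet lf rt v w"
    if "v \<in> verts G" "w \<in> verts G" for v w
    using le[OF that(1)] le[OF that(2)]
    by (simp add: trapezoid_def convex_hull_segs_eq_strip strips_meet_iff meet_def lf_def rt_def)
  then have "intersection_graph (verts G) (trapezoid T) = strip_graph (verts G) lf rt"
    by (rule intersection_graph_eq_strip_graph)
  then show "G = strip_graph (verts G) lf rt" using G by simp
qed

section \<open>The sequence of split graphs\<close>

locale iterated_splitting =
  fixes G :: "'a graph" and k :: nat and u u1 u2 :: "nat \<Rightarrow> 'a" and H :: "nat \<Rightarrow> 'a graph"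
  assumes u_inj: "inj_on u {1..k}" and u_verts: "u ` {1..k} \<subseteq> verts G"
    and H_0: "H 0 = G"
    and H_step: "i \<in> {1..k} \<Longrightarrow> vertex_splitting (H (i - 1)) (u i) (u1 i) (u2 i) (H i)"
begin

lemma H_Suc: "Suc i \<le> k \<Longrightarrow> vertex_splitting (H i) (u (Suc i)) (u1 (Suc i)) (u2 (Suc i)) (H (Suc i))"
  using H_step[of "Suc i"] by simp

abbreviation "unsplit i \<equiv> verts G - u ` {1..i}"

abbreviation "derivatives i \<equiv> u1 ` {1..i} \<union> u2 ` {1..i}"

lemma u_Suc_unsplit: "Suc i \<le> k \<Longrightarrow> u (Suc i) \<in> unsplit i"
proof -
  assume i: "Suc i \<le> k"
  have "u (Suc i) \<noteq> u j" if "j \<in> {1..i}" for j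
    using inj_onD[OF u_inj, of "Suc i" j] that i by auto
  moreover have "u (Suc i) \<in> verts G" using u_verts i by auto
  ultimately show ?thesis by blast
qed

lemma unsplit_Suc: "unsplit (Suc i) = unsplit i - {u (Suc i)}"
  by (auto simp: atLeastAtMostSuc_conv)

text \<open>Each pair is fresh in the graph in which it is created. A derivative may reuse the name
  of a vertex split earlier, hence disjointness is asserted only from the vertices not yet
  split.\<close>

lemma derivatives_distinct:
  "i \<le> k \<Longrightarrow> verts (H i) = unsplit i \<union> derivatives i \<and> unsplit i \<inter> derivatives i = {} \<and>
     inj_on u1 {1..i} \<and> inj_on u2 {1..i} \<and> u1 ` {1..i} \<inter> u2 ` {1..i} = {}"
proof (induction i)
  case 0
  then show ?case by (simp add: H_0)
next
  case (Suc i)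
  then have IH: "verts (H i) = unsplit i \<union> derivatives i" "unsplit i \<inter> derivatives i = {}"
    "inj_on u1 {1..i}" "inj_on u2 {1..i}" "u1 ` {1..i} \<inter> u2 ` {1..i} = {}" by auto
  have new: "u1 (Suc i) \<notin> verts (H i)" "u2 (Suc i) \<notin> verts (H i)" "u1 (Suc i) \<noteq> u2 (Suc i)"
    and H: "verts (H (Suc i)) = verts (H i) - {u (Suc i)} \<union> {u1 (Suc i), u2 (Suc i)}"
    using H_Suc[OF Suc.prems] by (auto simp: vertex_splitting_def)
  have w: "u (Suc i) \<in> unsplit i" by (rule u_Suc_unsplit[OF Suc.prems])
  have img: "f ` {1..Suc i} = insert (f (Suc i)) (f ` {1..i})" for f :: "nat \<Rightarrow> 'a"
    by (auto simp: atLeastAtMostSuc_conv)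
  have "verts (H (Suc i)) = unsplit (Suc i) \<union> derivatives (Suc i)"
    unfolding H IH(1) unsplit_Suc img[of u1] img[of u2] using w IH(2) by blast
  moreover have "unsplit (Suc i) \<inter> derivatives (Suc i) = {}"
    unfolding unsplit_Suc img[of u1] img[of u2] using new(1,2) IH(1,2) by blast
  moreover have "inj_on u1 {1..Suc i}" "inj_on u2 {1..Suc i}"
    using IH(3,4) new(1,2) unfolding IH(1) by (auto simp: atLeastAtMostSuc_conv)
  moreover have "u1 ` {1..Suc i} \<inter> u2 ` {1..Suc i} = {}"
  proof -
    have "u1 (Suc i) \<notin> u2 ` {1..i}" "u2 (Suc i) \<notin> u1 ` {1..i}"
      using new(1,2) unfolding IH(1) by simp_all
    then show ?thesis
      unfolding img[of u1] img[of u2] using new(3) IH(5) by simp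
  qed
  ultimately show ?case by (intro conjI)
qed

text \<open>The invariant of the iteration: unsplit vertices keep their original trapezoids, so the
  shadows assigned at each step are sides of original trapezoids.\<close>

lemma shadowed_rep_H:
  assumes T: "trapezoid_rep G T" and fin: "finite (verts G)"
  shows "i \<le> k \<Longrightarrow> \<exists>lf rt S. shadowed_rep (verts (H i)) lf rt (unsplit i) S \<and>
     H i = strip_graph (verts (H i)) lf rt \<and>
     (\<forall>v \<in> unsplit i. lf v = T (v, Left_Side) \<and> rt v = T (v, Right_Side)) \<and>
     (\<forall>j \<in> {1..i}. \<forall>x \<in> {u1 j, u2 j}. S x \<in> T ` ({u j} \<times> UNIV))"
proof (induction i)
  case 0
  show ?case
    using trapezoid_rep_imp_shadowed_rep[OF T fin] by (auto simp: H_0)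
next
  case (Suc i)
  let ?w = "u (Suc i)" and ?x1 = "u1 (Suc i)" and ?x2 = "u2 (Suc i)"
  obtain lf rt S where rep: "shadowed_rep (verts (H i)) lf rt (unsplit i) S"
    and Hi: "H i = strip_graph (verts (H i)) lf rt"
    and T_eq: "\<And>v. v \<in> unsplit i \<Longrightarrow> lf v = T (v, Left_Side) \<and> rt v = T (v, Right_Side)"
    and S: "\<And>j x. \<lbrakk>j \<in> {1..i}; x \<in> {u1 j, u2 j}\<rbrakk> \<Longrightarrow> S x \<in> T ` ({u j} \<times> UNIV)"
    using Suc by (metis Suc_leD)
  have split: "vertex_splitting (H i) ?w ?x1 ?x2 (H (Suc i))" by (rule H_Suc[OF Suc.prems])
  then have new: "?x1 \<notin> verts (H i)" "?x2 \<notin> verts (H i)" "?x1 \<noteq> ?x2"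
    and H: "verts (H (Suc i)) = verts (H i) - {?w} \<union> {?x1, ?x2}"
    by (auto simp: vertex_splitting_def)
  have split': "vertex_splitting (strip_graph (verts (H i)) lf rt) ?w ?x1 ?x2 (H (Suc i))"
    using split by (subst Hi[symmetric])
  have V: "verts (H i) = unsplit i \<union> derivatives i"
    using derivatives_distinct Suc.prems by (meson Suc_leD)
  have w: "?w \<in> unsplit i" by (rule u_Suc_unsplit[OF Suc.prems])
  obtain l1 l2 s1 s2 where s: "s1 \<in> {lf ?w, rt ?w}" "s2 \<in> {lf ?w, rt ?w}"
    and rep': "shadowed_rep (verts (H (Suc i))) (lf(?x1 := l1, ?x2 := l2))
       (rt(?x1 := l1, ?x2 := l2)) (unsplit (Suc i)) (S(?x1 := s1, ?x2 := s2))"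
    and H': "H (Suc i) = strip_graph (verts (H (Suc i))) (lf(?x1 := l1, ?x2 := l2))
       (rt(?x1 := l1, ?x2 := l2))"
    by (rule shadowed_rep.vertex_splitting_step[OF rep w split', folded H unsplit_Suc])
  have "(lf(?x1 := l1, ?x2 := l2)) v = T (v, Left_Side) \<and> (rt(?x1 := l1, ?x2 := l2)) v = T (v, Right_Side)"
    if "v \<in> unsplit (Suc i)" for v
  proof -
    have "v \<in> unsplit i" using that unsplit_Suc by blast
    moreover have "v \<noteq> ?x1" "v \<noteq> ?x2" using calculation V new by blast+
    ultimately show ?thesis using T_eq by simp
  qed
  moreover have "(S(?x1 := s1, ?x2 := s2)) x \<in> T ` ({u j} \<times> UNIV)"
    if j: "j \<in> {1..Suc i}" "x \<in> {u1 j, u2 j}" for j x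
  proof (cases "j = Suc i")
    case True
    then have "(S(?x1 := s1, ?x2 := s2)) x \<in> {s1, s2}" using j new by auto
    then show ?thesis using s T_eq[OF w] True by auto
  next
    case False
    then have j': "j \<in> {1..i}" using j by auto
    then have "x \<in> verts (H i)" using j V by blast
    then have "x \<noteq> ?x1" "x \<noteq> ?x2" using new by blast+
    then show ?thesis using S[OF j' j(2)] by simp
  qed
  ultimately show ?case
    using rep' H' by (intro exI[of _ "lf(?x1 := l1, ?x2 := l2)"] exI[of _ "rt(?x1 := l1, ?x2 := l2)"]
        exI[of _ "S(?x1 := s1, ?x2 := s2)"] conjI) blast+
qed

text \<open>On the derivatives alone the representation consists of lines. Shadows carry each arc to
  an arc between sides of original trapezoids, so \<open>u\<close> maps one merged digraph into the
  other.\<close>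

lemma permutation_rep_derivatives:
  assumes T: "trapezoid_rep G T" and fin: "finite (verts G)"
  defines "GU \<equiv> induced (H k) (verts (H k) - unsplit k)"
  obtains R where "permutation_rep GU R" "finite_simple_graph GU" "verts GU = derivatives k"
    "\<And>i j. (i, j) \<in> merged_digraph GU R {1..k} u1 u2 \<Longrightarrow>
       (u i, u j) \<in> merged_digraph (line_graph (verts G \<times> UNIV) T) T (verts G)
         (\<lambda>v. (v, Left_Side)) (\<lambda>v. (v, Right_Side))"
proof -
  obtain lf rt S where "shadowed_rep (verts (H k)) lf rt (unsplit k) S"
    and Hk: "H k = strip_graph (verts (H k)) lf rt"
    and S: "\<And>j x. \<lbrakk>j \<in> {1..k}; x \<in> {u1 j, u2 j}\<rbrakk> \<Longrightarrow> S x \<in> T ` ({u j} \<times> UNIV)"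
    using shadowed_rep_H[OF T fin, of k] by blast
  then interpret r: shadowed_rep "verts (H k)" lf rt "unsplit k" S by blast
  define D where "D = verts (H k) - unsplit k"
  have D: "D = derivatives k" using derivatives_distinct[of k] unfolding D_def by blast
  have line: "lf z = rt z" if "z \<in> D" for z using that r.derivative_is_line by (simp add: D_def)
  have GU: "GU = strip_graph D lf rt"
    unfolding GU_def D_def by (subst Hk) (simp add: induced_strip_graph Int_absorb1 Diff_subset)
  have vGU: "verts GU = D" by (simp add: GU)
  have differ: "fst (lf x) \<noteq> fst (lf y) \<and> snd (lf x) \<noteq> snd (lf y)"
    if "x \<in> D" "y \<in> D" "x \<noteq> y" for x y
    using r.endpoints_differ[of x y "lf x" "lf y"] that by (simp add: D_def)
  show thesis
  proof
    have "distinct_endpoints D lf"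
      using differ by (fastforce simp: distinct_endpoints_def inj_on_def top_pt_def bot_pt_def)
    then show "permutation_rep GU lf"
      unfolding permutation_rep_def vGU using line_graph_eq_strip_graph[of D lf rt, OF line] GU by simp
    show "finite_simple_graph GU"
      unfolding GU using r.finite_V by (intro finite_simple_strip_graph) (simp add: D_def)
    show "verts GU = derivatives k" using vGU D by simp
  next
    fix i j assume ij: "(i, j) \<in> merged_digraph GU lf {1..k} u1 u2"
    then obtain x y where i: "i \<in> {1..k}" "j \<in> {1..k}" "i \<noteq> j"
      and x: "x \<in> {u1 i, u2 i}" and y: "y \<in> {u1 j, u2 j}"
      and edge: "{x, y} \<in> edges GU" and theta: "theta (lf x) < theta (lf y)"
      by (auto simp: merged_digraph_def Phi_def)
    have xy: "x \<in> D" "y \<in> D" "x \<noteq> y" "meet lf rt x y" using edge by (simp_all add: GU)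
    have "cuts (lf x) (lf y)"
      using cuts_if_meet_theta_less[OF _ _ _ _ theta] differ[OF xy(1-3)] xy line
      by (simp add: meet_def)
    then have cut: "cuts (S x) (S y)" using r.shadow_cuts xy unfolding D_def by blast
    obtain a where a: "S x = T (u i, a)" using S[OF i(1) x] by auto
    obtain b where b: "S y = T (u j, b)" using S[OF i(2) y] by auto
    have uij: "u i \<in> verts G" "u j \<in> verts G" "u i \<noteq> u j"
      using u_verts i inj_onD[OF u_inj] by auto
    have "((u i, a), (u j, b)) \<in> Phi (line_graph (verts G \<times> UNIV) T) T"
      using cut uij unfolding a b by (intro cuts_imp_arc) auto
    moreover have "(v, c) \<in> {(v, Left_Side), (v, Right_Side)}" for v :: 'a and c
      by (cases c) auto
    ultimately show "(u i, u j) \<in> merged_digraph (line_graph (verts G \<times> UNIV) T) T (verts G)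
         (\<lambda>v. (v, Left_Side)) (\<lambda>v. (v, Right_Side))"
      using uij unfolding merged_digraph_def by blast
  qed
qed

end

text \<open>A directed cycle in \<open>s\<close> would be mapped to a closed walk of positive length
  in \<open>r\<close>.\<close>

lemma acyclic_vimage:
  assumes "acyclic r" "\<And>i j. (i, j) \<in> s \<Longrightarrow> (f i, f j) \<in> r"
  shows "acyclic s"
proof -
  have "(f i, f j) \<in> r\<^sup>+" if "(i, j) \<in> s\<^sup>+" for i j
    using that by (induction rule: trancl_induct) (auto intro: assms(2) trancl_into_trancl)
  then show ?thesis using assms(1) unfolding acyclic_def by blast
qed

theorem theorem2p14:
  fixes G GU :: "'a graph"
    and U :: "'a set"
    and k :: nat
    and u u1 u2 :: "nat \<Rightarrow> 'a"
    and H :: "nat \<Rightarrow> 'a graph"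
  assumes "trapezoid_graph G"
    and "U \<subseteq> verts G"
    and "bij_betw u {1..k} U"
    and "\<forall>i \<in> {1..k}. \<exists>d ds. delta_choice G (u i) d ds \<and> ds \<noteq> {}"
    and "H 0 = G"
    and "\<forall>i \<in> {1..k}. vertex_splitting (H (i - 1)) (u i) (u1 i) (u2 i) (H i)"
    and "GU = induced (H k) (verts (H k) - (verts G - U))"
  shows "permutation_graph GU \<and> card (verts GU) = 2 * k \<and>
    (acyclic_trapezoid_graph G \<longrightarrow> acyclic_permutation_graph GU {1..k} u1 u2)"
proof -
  have U: "U = u ` {1..k}" using assms(3) by (simp add: bij_betw_def)
  interpret iterated_splitting G k u u1 u2 H
  proof
    show "inj_on u {1..k}" using assms(3) by (simp add: bij_betw_def)
    show "u ` {1..k} \<subseteq> verts G" using assms(2) U by simp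
    show "H 0 = G" by (rule assms(5))
    show "\<And>i. i \<in> {1..k} \<Longrightarrow> vertex_splitting (H (i - 1)) (u i) (u1 i) (u2 i) (H i)"
      using assms(6) by blast
  qed
  have GU: "GU = induced (H k) (verts (H k) - unsplit k)" using assms(7) U by simp
  have fin: "finite (verts G)" using assms(1) by (simp add: trapezoid_graph_def finite_simple_graph_def)
  have der: "inj_on u1 {1..k}" "inj_on u2 {1..k}" "u1 ` {1..k} \<inter> u2 ` {1..k} = {}"
    using derivatives_distinct[of k] by auto
  obtain T where T: "trapezoid_rep G T" using assms(1) by (auto simp: trapezoid_graph_def)
  obtain R where R: "permutation_rep GU R" "finite_simple_graph GU" "verts GU = derivatives k"
    by (rule permutation_rep_derivatives[OF T fin, folded GU])
  have "card (verts GU) = 2 * k"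
    using der by (simp add: R(3) card_Un_disjoint card_image)
  moreover have "acyclic_permutation_graph GU {1..k} u1 u2" if acyc: "acyclic_trapezoid_graph G"
  proof -
    \<comment> \<open>Acyclicity belongs to a representation, so the construction is carried out
      again from an acyclic one; it yields lines for the same graph \<open>GU\<close>.\<close>
    obtain T' where T': "trapezoid_rep G T'"
      and acyc': "acyclic (merged_digraph (line_graph (verts G \<times> UNIV) T') T' (verts G)
         (\<lambda>v. (v, Left_Side)) (\<lambda>v. (v, Right_Side)))"
      using acyc by (auto simp: acyclic_trapezoid_graph_def acyclic_trapezoid_rep_def
          acyclic_permutation_rep_def)
    obtain R' where R': "permutation_rep GU R'"
      and arcs: "\<And>i j. (i, j) \<in> merged_digraph GU R' {1..k} u1 u2 \<Longrightarrow>
       (u i, u j) \<in> merged_digraph (line_graph (verts G \<times> UNIV) T') T' (verts G)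
         (\<lambda>v. (v, Left_Side)) (\<lambda>v. (v, Right_Side))"
      by (rule permutation_rep_derivatives[OF T' fin, folded GU]) blast
    have "acyclic (merged_digraph GU R' {1..k} u1 u2)"
      by (rule acyclic_vimage[OF acyc' arcs])
    moreover have "grouped_into_pairs GU {1..k} u1 u2"
      using der R(3) by (simp add: grouped_into_pairs_def)
    ultimately show ?thesis
      using R(2) R' by (auto simp: acyclic_permutation_graph_def acyclic_permutation_rep_def)
  qed
  ultimately show ?thesis using R by (auto simp: permutation_graph_def)
qed

end
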